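(* The formal power series $G=G(\mathsf{x};\bar\lambda,\lambda,\bar\rho,\rho)$, the generating function of labeled plane binary trees by left ascents, left descents, right ascents and right descents, is Schur positive: it is a (possibly infinite) sum of Schur functions $s_\mu$ in $\mathsf{x}$ with coefficients in the semiring $\mathbb{N}[\bar\lambda,\lambda,\bar\rho,\rho]$ of polynomials with nonnegative integer coefficients.
   Context: A (plane binary) tree is a rooted tree in which every node has at most one left child and at most one right child (it may have only one of the two), and no other children. A labeled tree is a tree whose nodes are labeled with positive integers, repetitions allowed; $\mathcal{T}^{\ell}_n$ is the set of labeled trees on $n\ge 1$ nodes. Write $v^\ell$ for the label of a node $v$. If $v$ is the left child of $w$, the edge between them is a left ascent if $v^\ell\le w^\ell$ and a left descent otherwise. If $w$ is the right child of $v$, the edge between them is a right ascent if $v^\ell\le w^\ell$ and a right descent otherwise. Let $\mathrm{lasc}(T),\mathrm{ldes}(T),\mathrm{rasc}(T),\mathrm{rdes}(T)$ be the numbers of left ascents, left descents, right ascents and right descents of $T$. Let $\mathsf{x}=\{x_1,x_2,\dots\}$ be commuting indeterminates, $\mathsf{x}^T=\prod_{v\in T}x_{v^\ell}$, and let $\bar\lambda,\lambda,\bar\rho,\rho$ be commuting indeterminates. Define the formal power series in $\mathsf{x}$ with coefficients in $\mathbb{Q}[\bar\lambda,\lambda,\bar\rho,\rho]$ $$G=\sum_{n\ge 1}\sum_{T\in\mathcal{T}^\ell_n}\bar\lambda^{\mathrm{lasc}(T)}\lambda^{\mathrm{ldes}(T)}\bar\rho^{\,\mathrm{rasc}(T)}\rho^{\,\mathrm{rdes}(T)}\,\mathsf{x}^T.$$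 *)

theory Defs
  imports Complex_Main "HOL-Library.Tree" "HOL-Library.Poly_Mapping"
begin

section \<open>Coefficient ring and formal power series\<close>

text \<open>The four indeterminates of the coefficient ring: \<open>Lam_bar\<close> and \<open>Lam\<close> mark left ascents and
  left descents, \<open>Rho_bar\<close> and \<open>Rho\<close> mark right ascents and right descents.\<close>

datatype param = Lam_bar | Lam | Rho_bar | Rho

text \<open>Multivariate polynomials are finitely supported maps from exponent vectors to coefficients;
  multiplication on \<^typ>\<open>('a::monoid_add \<Rightarrow>\<^sub>0 'b::semiring_0)\<close> is convolution.\<close>

type_synonym coeff_poly = "(param \<Rightarrow>\<^sub>0 nat) \<Rightarrow>\<^sub>0 rat"

definition param_var :: "param \<Rightarrow> coeff_poly" where
  "param_var v = Poly_Mapping.single (Poly_Mapping.single v 1) 1"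

definition nat_coeff_polys :: "coeff_poly set" where
  "nat_coeff_polys = {p. \<forall>e. Poly_Mapping.lookup p e \<in> \<nat>}"

text \<open>A formal power series in \<open>x\<^sub>1, x\<^sub>2, \<dots>\<close> maps every monomial, given by its
  exponent vector, to its coefficient.  All labels and tableau entries below are positive, so the
  index 0 never occurs.\<close>

type_synonym power_series = "(nat \<Rightarrow>\<^sub>0 nat) \<Rightarrow> coeff_poly"

definition series_monom :: "coeff_poly \<Rightarrow> (nat \<Rightarrow>\<^sub>0 nat) \<Rightarrow> power_series" where
  "series_monom c m = (\<lambda>m'. if m' = m then c else 0)"

definition series_scale :: "coeff_poly \<Rightarrow> power_series \<Rightarrow> power_series" where
  "series_scale c F = (\<lambda>m. c * F m)"

text \<open>Infinite sums of formal power series: only finitely many terms contribute to the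
  coefficient of any given monomial.\<close>

definition formally_summable :: "'i set \<Rightarrow> ('i \<Rightarrow> power_series) \<Rightarrow> bool" where
  "formally_summable I f \<longleftrightarrow> (\<forall>m. finite {i \<in> I. f i m \<noteq> 0})"

definition formal_sum :: "'i set \<Rightarrow> ('i \<Rightarrow> power_series) \<Rightarrow> power_series" where
  "formal_sum I f = (\<lambda>m. \<Sum>i\<in>{i \<in> I. f i m \<noteq> 0}. f i m)"

definition formally_sums :: "'i set \<Rightarrow> ('i \<Rightarrow> power_series) \<Rightarrow> power_series \<Rightarrow> bool" where
  "formally_sums I f F \<longleftrightarrow> formally_summable I f \<and> formal_sum I f = F"

text \<open>The exponent vector of \<open>\<Prod>i\<leftarrow>w. x\<^sub>i\<close>.\<close>

definition content :: "nat list \<Rightarrow> (nat \<Rightarrow>\<^sub>0 nat)" where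
  "content w = (\<Sum>i\<leftarrow>w. Poly_Mapping.single i 1)"

section \<open>Schur functions\<close>

definition partition :: "nat list \<Rightarrow> bool" where
  "partition \<mu> \<longleftrightarrow> sorted_wrt (\<ge>) \<mu> \<and> 0 \<notin> set \<mu>"

text \<open>A tableau is the list of its rows, from the longest to the shortest.\<close>

definition ssyt :: "nat list \<Rightarrow> nat list list set" where
  "ssyt \<mu> = {t. map length t = \<mu> \<and>
     (\<forall>row \<in> set t. sorted row \<and> 0 \<notin> set row) \<and>
     (\<forall>i j. Suc i < length t \<longrightarrow> j < length (t ! Suc i) \<longrightarrow> t ! i ! j < t ! Suc i ! j)}"

definition schur :: "nat list \<Rightarrow> power_series" where
  "schur \<mu> = formal_sum (ssyt \<mu>) (\<lambda>t. series_monom 1 (content (concat t)))"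

definition schur_positive :: "power_series \<Rightarrow> bool" where
  "schur_positive F \<longleftrightarrow>
     (\<exists>c. (\<forall>\<mu>. partition \<mu> \<longrightarrow> c \<mu> \<in> nat_coeff_polys) \<and>
          formally_sums {\<mu>. partition \<mu>} (\<lambda>\<mu>. series_scale (c \<mu>) (schur \<mu>)) F)"

section \<open>Labeled plane binary trees\<close>

text \<open>In \<^typ>\<open>nat tree\<close> the nodes are the \<^const>\<open>Node\<close> constructors and \<^const>\<open>Leaf\<close> stands
  for a missing child.\<close>

definition labeled_trees :: "nat \<Rightarrow> nat tree set" where
  "labeled_trees n = {T. size T = n \<and> 0 \<notin> set_tree T}"

fun lasc :: "nat tree \<Rightarrow> nat" where
  "lasc Leaf = 0"
| "lasc (Node l w r) =
     (case l of Leaf \<Rightarrow> 0 | Node _ v _ \<Rightarrow> if v \<le> w then 1 else 0) + lasc l + lasc r"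

fun ldes :: "nat tree \<Rightarrow> nat" where
  "ldes Leaf = 0"
| "ldes (Node l w r) =
     (case l of Leaf \<Rightarrow> 0 | Node _ v _ \<Rightarrow> if v \<le> w then 0 else 1) + ldes l + ldes r"

fun rasc :: "nat tree \<Rightarrow> nat" where
  "rasc Leaf = 0"
| "rasc (Node l v r) =
     (case r of Leaf \<Rightarrow> 0 | Node _ w _ \<Rightarrow> if v \<le> w then 1 else 0) + rasc l + rasc r"

fun rdes :: "nat tree \<Rightarrow> nat" where
  "rdes Leaf = 0"
| "rdes (Node l v r) =
     (case r of Leaf \<Rightarrow> 0 | Node _ w _ \<Rightarrow> if v \<le> w then 0 else 1) + rdes l + rdes r"

definition tree_weight :: "nat tree \<Rightarrow> coeff_poly" where
  "tree_weight T = param_var Lam_bar ^ lasc T * param_var Lam ^ ldes T *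
                   param_var Rho_bar ^ rasc T * param_var Rho ^ rdes T"

definition tree_series :: power_series where
  "tree_series = formal_sum (\<Union>n\<in>{1..}. labeled_trees n)
     (\<lambda>T. series_monom (tree_weight T) (content (inorder T)))"

section \<open>Well-definedness of the infinite sums\<close>

lemma lookup_content: "Poly_Mapping.lookup (content w) i = count_list w i"
  by (induction w) (auto simp: content_def lookup_add lookup_single)

lemma content_eq_bounds:
  assumes "content w = m"
  shows "set w \<subseteq> Poly_Mapping.keys m"
    and "length w = (\<Sum>i\<in>Poly_Mapping.keys m. Poly_Mapping.lookup m i)"
proof -
  have keys: "Poly_Mapping.keys m = set w"
    using assms by (auto simp: in_keys_iff lookup_content count_list_0_iff)
  then show "set w \<subseteq> Poly_Mapping.keys m" by simp
  show "length w = (\<Sum>i\<in>Poly_Mapping.keys m. Poly_Mapping.lookup m i)"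
    unfolding keys using assms by (auto simp: lookup_content sum_count_set)
qed

lemma finite_trees_bounded:
  assumes "finite A"
  shows "finite {T. size T \<le> n \<and> set_tree T \<subseteq> A}"
proof (induction n)
  case 0
  have "{T. size T \<le> 0 \<and> set_tree T \<subseteq> A} \<subseteq> {Leaf}" by auto
  then show ?case by (rule finite_subset) simp
next
  case (Suc n)
  let ?S = "{T. size T \<le> n \<and> set_tree T \<subseteq> A}"
  have "{T. size T \<le> Suc n \<and> set_tree T \<subseteq> A}
          \<subseteq> insert Leaf ((\<lambda>(l, a, r). Node l a r) ` (?S \<times> A \<times> ?S))"
  proof
    fix T assume "T \<in> {T. size T \<le> Suc n \<and> set_tree T \<subseteq> A}"
    then show "T \<in> insert Leaf ((\<lambda>(l, a, r). Node l a r) ` (?S \<times> A \<times> ?S))"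
      by (cases T) (auto simp: image_iff)
  qed
  then show ?case
    by (rule finite_subset) (use Suc assms in auto)
qed

lemma formally_summable_tree_series:
  "formally_summable (\<Union>n\<in>{1..}. labeled_trees n)
     (\<lambda>T. series_monom (tree_weight T) (content (inorder T)))"
  unfolding formally_summable_def
proof
  fix m :: "nat \<Rightarrow>\<^sub>0 nat"
  let ?K = "Poly_Mapping.keys m"
  let ?N = "\<Sum>i\<in>?K. Poly_Mapping.lookup m i"
  have "{T \<in> (\<Union>n\<in>{1..}. labeled_trees n).
            series_monom (tree_weight T) (content (inorder T)) m \<noteq> 0}
          \<subseteq> {T. size T \<le> ?N \<and> set_tree T \<subseteq> ?K}"
  proof
    fix T
    assume "T \<in> {T \<in> (\<Union>n\<in>{1..}. labeled_trees n).
              series_monom (tree_weight T) (content (inorder T)) m \<noteq> 0}"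
    then have "content (inorder T) = m"
      by (auto simp: series_monom_def split: if_splits)
    from content_eq_bounds[OF this] show "T \<in> {T. size T \<le> ?N \<and> set_tree T \<subseteq> ?K}"
      by simp
  qed
  then show "finite {T \<in> (\<Union>n\<in>{1..}. labeled_trees n).
            series_monom (tree_weight T) (content (inorder T)) m \<noteq> 0}"
    by (rule finite_subset) (simp add: finite_trees_bounded)
qed

lemma formally_summable_schur:
  "formally_summable (ssyt \<mu>) (\<lambda>t. series_monom 1 (content (concat t)))"
  unfolding formally_summable_def
proof
  fix m :: "nat \<Rightarrow>\<^sub>0 nat"
  let ?K = "Poly_Mapping.keys m"
  let ?R = "{row. set row \<subseteq> ?K \<and> length row \<le> sum_list \<mu>}"
  have "{t \<in> ssyt \<mu>. series_monom 1 (content (concat t)) m \<noteq> 0}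
          \<subseteq> {t. set t \<subseteq> ?R \<and> length t = length \<mu>}"
  proof
    fix t assume t: "t \<in> {t \<in> ssyt \<mu>. series_monom 1 (content (concat t)) m \<noteq> 0}"
    then have mu: "map length t = \<mu>" and c: "content (concat t) = m"
      by (auto simp: ssyt_def series_monom_def split: if_splits)
    have "length row \<le> sum_list \<mu>" if "row \<in> set t" for row
      unfolding mu[symmetric] using that by (intro member_le_sum_list) auto
    then show "t \<in> {t. set t \<subseteq> ?R \<and> length t = length \<mu>}"
      using content_eq_bounds(1)[OF c] mu by auto
  qed
  then show "finite {t \<in> ssyt \<mu>. series_monom 1 (content (concat t)) m \<noteq> 0}"
    by (rule finite_subset) (intro finite_lists_length_eq finite_lists_length_le finite_keys)
qed

end

theory Submission
  imports "HOL-Computational_Algebra.Formal_Power_Series" Defs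
begin

text \<open>
  Restrict the labels to \<open>1, \<dots>, N\<close> and let \<open>S\<^sub>i\<close> be the series of the trees with root label at most
  \<open>i\<close>.  Removing the root gives a recursion \<open>S\<^sub>i - S\<^sub>i\<^sub>-\<^sub>1 = x\<^sub>i p\<^sub>i q\<^sub>i\<^sub>-\<^sub>1\<close> with \<open>p\<^sub>i\<close> and \<open>q\<^sub>i\<close> affine in
  \<open>S\<^sub>i\<close> (with coefficients involving \<open>G\<close>).  This discrete Riccati equation can be linearized, and
  its linear form is the transfer system for words: \<open>G\<close> equals the sum over all nonempty words in
  which every adjacent pair contributes a factor \<open>a\<close> or \<open>b\<close> according to whether it is an ascent or a
  descent, where \<open>a\<close> and \<open>b\<close> are \<open>rb + lb + rb lb G\<close> and \<open>r + l + r l G\<close>; here \<open>lb, l, rb, r\<close> mark left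
  ascents, left descents, right ascents and right descents.  Iterating this fixed point equation
  writes \<open>G\<close> as a positive combination of products of ribbon Schur functions, hence of ribbon Schur
  functions.  RSK turns the sum over all words with a given descent set into Schur functions.
\<close>

unbundle fps_syntax

fun adj :: "('a \<Rightarrow> 'a \<Rightarrow> bool) \<Rightarrow> 'a list \<Rightarrow> bool list" where
  "adj R (x # y # w) = R x y # adj R (y # w)"
| "adj R _ = []"

lemma content_Nil [simp]: "content [] = 0"
  by (simp add: content_def)

lemma content_Cons: "content (x # w) = Poly_Mapping.single x 1 + content w"
  by (simp add: content_def)

lemma content_append: "content (u @ v) = content u + content v"
  by (simp add: content_def)

section \<open>The Robinson--Schensted--Knuth correspondence\<close>

fun row_insert :: "nat \<Rightarrow> nat list \<Rightarrow> nat list \<times> nat option" where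
  "row_insert x [] = ([x], None)"
| "row_insert x (y # r) =
     (if x < y then (x # r, Some y) else (let (r', b) = row_insert x r in (y # r', b)))"

fun tableau_insert :: "nat \<Rightarrow> nat list list \<Rightarrow> nat list list \<times> nat" where
  "tableau_insert x [] = ([[x]], 0)"
| "tableau_insert x (r # t) =
     (case row_insert x r of
        (r', None) \<Rightarrow> (r' # t, 0)
      | (r', Some y) \<Rightarrow> (let (t', k) = tableau_insert y t in (r' # t', Suc k)))"

text \<open>\<open>strictly_below r s\<close>: the row \<open>s\<close> may be placed directly under the row \<open>r\<close>.\<close>

fun strictly_below :: "nat list \<Rightarrow> nat list \<Rightarrow> bool" where
  "strictly_below r [] = True"
| "strictly_below [] (b # s) = False"
| "strictly_below (a # r) (b # s) = (a < b \<and> strictly_below r s)"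

fun tableau :: "nat list list \<Rightarrow> bool" where
  "tableau [] = True"
| "tableau (r # t) = (sorted r \<and> r \<noteq> [] \<and> 0 \<notin> set r \<and> tableau t \<and>
     (case t of [] \<Rightarrow> True | s # _ \<Rightarrow> strictly_below r s))"

text \<open>The recording tableau is encoded by the list of the rows (counted from 0) in which the boxes
  were added, the last added box coming first.\<close>

fun add_box :: "nat \<Rightarrow> nat list \<Rightarrow> nat list" where
  "add_box 0 [] = [1]"
| "add_box 0 (m # \<mu>) = Suc m # \<mu>"
| "add_box (Suc k) [] = []"
| "add_box (Suc k) (m # \<mu>) = m # add_box k \<mu>"

fun shape_of :: "nat list \<Rightarrow> nat list" where
  "shape_of [] = []"
| "shape_of (k # q) = add_box k (shape_of q)"

text \<open>The suffixes of such a word give a chain of partitions growing by one box at a time,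
  that is, a standard Young tableau. The bound on \<open>k\<close> excludes the last two equations
  of \<open>add_box\<close> from running off the shape, where no box would be added.\<close>

fun lattice_word :: "nat list \<Rightarrow> bool" where
  "lattice_word [] = True"
| "lattice_word (k # q) = (lattice_word q \<and> k \<le> length (shape_of q) \<and> partition (shape_of (k # q)))"

text \<open>Words are inserted from right to left, so that recursion is on \<^const>\<open>Cons\<close>; hence strict
  rises of the word become strict falls of the list of row indices.\<close>

fun rsk :: "nat list \<Rightarrow> nat list list \<times> nat list" where
  "rsk [] = ([], [])"
| "rsk (x # w) = (let (t, q) = rsk w; (t', k) = tableau_insert x t in (t', k # q))"

section \<open>Row insertion and reverse bumping in a single row\<close>

lemma row_insert_content:
  "row_insert x r = (r', b) \<Longrightarrow>
     content r' + (case b of None \<Rightarrow> 0 | Some y \<Rightarrow> Poly_Mapping.single y 1) =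
     Poly_Mapping.single x 1 + content r"
proof (induction x r arbitrary: r' b rule: row_insert.induct)
  case (2 x y r)
  show ?case
  proof (cases "x < y")
    case False
    then obtain s where s: "row_insert x r = (s, b)" "r' = y # s"
      using 2 by (auto split: prod.splits)
    have "Poly_Mapping.single y 1 +
        (content s + (case b of None \<Rightarrow> 0 | Some y \<Rightarrow> Poly_Mapping.single y 1)) =
        Poly_Mapping.single y 1 + (Poly_Mapping.single x 1 + content r)"
      by (simp only: "2.IH"[OF False s(1)])
    then show ?thesis
      by (simp only: s(2) content_Cons ac_simps)
  qed (use 2 in \<open>auto simp: content_Cons ac_simps\<close>)
qed (auto simp: content_Cons)

lemma row_insert_set:
  "row_insert x r = (r', b) \<Longrightarrow> set r' \<subseteq> insert x (set r) \<and> x \<in> set r'"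
  by (induction x r arbitrary: r' b rule: row_insert.induct)
     (auto split: if_splits prod.splits)

lemma row_insert_None: "row_insert x r = (r', None) \<Longrightarrow> r' = r @ [x]"
  by (induction x r arbitrary: r' rule: row_insert.induct)
     (auto split: if_splits prod.splits)

lemma row_insert_Some:
  "row_insert x r = (r', Some y) \<Longrightarrow>
     x < y \<and> y \<in> set r \<and> length r' = length r \<and> set r \<subseteq> insert y (set r')"
  by (induction x r arbitrary: r' rule: row_insert.induct)
     (auto split: if_splits prod.splits)

lemma row_insert_sorted: "row_insert x r = (r', b) \<Longrightarrow> sorted r \<Longrightarrow> sorted r'"
proof (induction x r arbitrary: r' b rule: row_insert.induct)
  case (2 x y r)
  show ?case
  proof (cases "x < y")
    case False
    then obtain s where s: "row_insert x r = (s, b)" "r' = y # s"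
      using 2 by (auto split: prod.splits)
    then show ?thesis
      using 2 False row_insert_set[OF s(1)] by auto
  qed (use 2 in force)
qed auto

text \<open>Reverse bumping is determined: in the sorted row \<open>r'\<close> the inserted letter
  is the last entry smaller than \<open>y\<close>, and \<open>y\<close> goes back to its
  place.\<close>

lemma row_insert_inj_Some:
  "row_insert x r = (r', Some y) \<Longrightarrow> row_insert x' s = (r', Some y) \<Longrightarrow> sorted r \<Longrightarrow> sorted s
     \<Longrightarrow> x = x' \<and> r = s"
proof (induction r arbitrary: s r')
  case (Cons a r)
  then obtain b s0 where s: "s = b # s0" by (cases s) auto
  \<comment> \<open>The inserted letter lies in the new row and is smaller than the bumped one. This
    rules out the mixed cases, where only one of the two insertions bumps its first entry.\<close>
  have contra: False if "row_insert z t = (v, Some y)" "\<forall>e\<in>set v. y \<le> e" for z t v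
    using that row_insert_Some row_insert_set by fastforce
  show ?case
  proof (cases "x < a"; cases "x' < b")
    assume "\<not> x < a" "\<not> x' < b"
    then show ?thesis
      using Cons.prems Cons.IH unfolding s by (auto split: prod.splits)
  qed (use Cons.prems contra s in \<open>auto split: prod.splits\<close>)
qed auto

lemma row_insert_total_None:
  assumes "sorted (r @ [x])" shows "row_insert x r = (r @ [x], None)"
  using assms by (induction r) auto

text \<open>Reverse bumping is possible as soon as the first entry is smaller than \<open>y\<close>.
  That \<open>x\<close> comes from the row is recorded so that it is later seen to be
  positive.\<close>

lemma row_insert_ex:
  "sorted (a # r') \<Longrightarrow> a < y \<Longrightarrow> \<exists>x r. sorted r \<and> row_insert x r = (a # r', Some y) \<and> x \<in> set (a # r')"
proof (induction r' arbitrary: a)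
  case Nil
  then show ?case by (intro exI[of _ a] exI[of _ "[y]"]) auto
next
  case (Cons b r')
  show ?case
  proof (cases "b < y")
    case True
    then obtain x r where xr: "sorted r" "row_insert x r = (b # r', Some y)" "x \<in> set (b # r')"
      using Cons.IH[of b] Cons.prems by auto
    have "a \<le> x" using xr(3) Cons.prems by auto
    moreover have "\<forall>e\<in>set r. a \<le> e"
      using row_insert_Some[OF xr(2)] Cons.prems by force
    ultimately show ?thesis
      using xr by (intro exI[of _ x] exI[of _ "a # r"]) auto
  next
    case False
    then show ?thesis using Cons.prems by (intro exI[of _ a] exI[of _ "y # b # r'"]) auto
  qed
qed

section \<open>Strict columns under row insertion and its reversal\<close>

lemma strictly_below_row_insert_left:
  "row_insert x r = (r', Some y) \<Longrightarrow> strictly_below r s \<Longrightarrow> strictly_below r' s"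
proof (induction r s arbitrary: r' rule: strictly_below.induct)
  case (3 a r b s)
  then show ?case by (auto split: if_splits prod.splits)
qed auto

lemma strictly_below_append: "strictly_below r s \<Longrightarrow> strictly_below (r @ r') s"
  by (induction r s rule: strictly_below.induct) auto

text \<open>The bumped letter \<open>y\<close> enters \<open>s\<close> in the column it left or
  further to the left, because the entry that was below it, if any, is larger. There it stands under
  an entry smaller than itself.\<close>

lemma strictly_below_row_insert:
  "row_insert x r = (r', Some y) \<Longrightarrow> row_insert y s = (s', b) \<Longrightarrow> strictly_below r s \<Longrightarrow>
   strictly_below r' s'"
proof (induction r s arbitrary: r' s' rule: strictly_below.induct)
  case (1 r)
  then show ?case by (cases r) (auto split: if_splits prod.splits dest: row_insert_Some)
next
  case (3 a r c s)
  show ?case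
  proof (cases "x < a")
    case False
    then obtain r0 where r0: "row_insert x r = (r0, Some y)" "r' = a # r0"
      using "3.prems" by (auto split: prod.splits)
    show ?thesis
      using "3.prems" False r0 "3.IH"[OF r0(1)] strictly_below_row_insert_left[OF r0(1)]
        row_insert_Some[OF r0(1)]
      by (auto split: if_splits prod.splits)
  qed (use 3 in auto)
qed auto

text \<open>The entry above the new place of \<open>y\<close> is such an \<open>e\<close>. It allows
  \<open>y\<close> to be bumped back into the row above.\<close>

lemma strictly_below_row_insert_ex:
  "row_insert y s = (s', b) \<Longrightarrow> strictly_below r s' \<Longrightarrow> \<exists>e\<in>set r. e < y"
proof (induction r s' arbitrary: s rule: strictly_below.induct)
  case (1 r)
  then show ?case by (cases s) (auto split: if_splits prod.splits)
next
  case (3 a r c s')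
  then show ?case by (cases s) (auto split: if_splits prod.splits)
qed auto

lemma strictly_below_row_uninsert_left:
  "row_insert x r = (r', Some y) \<Longrightarrow> strictly_below r' s \<Longrightarrow> \<forall>e\<in>set s. y < e \<Longrightarrow> strictly_below r s"
proof (induction r s arbitrary: r' rule: strictly_below.induct)
  case (3 a r b s)
  then show ?case by (auto split: if_splits prod.splits)
qed auto

text \<open>Going back up, \<open>y\<close> moves to the column of the last entry of
  \<open>r'\<close> smaller than \<open>y\<close>, which is not to the left of its column in
  \<open>s'\<close>. All entries of \<open>s\<close> from there on exceed \<open>y\<close>.\<close>

lemma strictly_below_row_uninsert:
  "row_insert x r = (r', Some y) \<Longrightarrow> row_insert y s = (s', b) \<Longrightarrow> sorted r \<Longrightarrow> sorted s \<Longrightarrow>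
   strictly_below r' s' \<Longrightarrow> strictly_below r s"
proof (induction r s arbitrary: r' s' rule: strictly_below.induct)
  case (3 a r c s)
  show ?case
  proof (cases "x < a")
    case True
    then have *: "r' = x # r" "y = a" using "3.prems" by auto
    show ?thesis
    proof (cases "a < c")
      case False
      then obtain s0 where "row_insert a s = (s0, b)" "s' = c # s0"
        using "3.prems" * by (auto split: prod.splits)
      \<comment> \<open>Here \<open>a\<close> lands in a later column, under an entry of
        \<open>r\<close> smaller than \<open>a\<close>; this contradicts that \<open>a # r\<close>
        is sorted.\<close>
      then show ?thesis
        using strictly_below_row_insert_ex[of a s s0 b r] "3.prems" * by fastforce
    qed (use "3.prems" * in auto)
  next
    case False
    then obtain r0 where r0: "row_insert x r = (r0, Some y)" "r' = a # r0"
      using "3.prems" by (auto split: prod.splits)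
    show ?thesis
    proof (cases "y < c")
      case True
      moreover have "\<forall>e\<in>set s. y < e"
        using "3.prems"(4) True by fastforce
      ultimately show ?thesis
        using "3.prems" r0 strictly_below_row_uninsert_left[OF r0(1), of s] by auto
    next
      case F: False
      then obtain s0 where "row_insert y s = (s0, b)" "s' = c # s0"
        using "3.prems" by (auto split: prod.splits)
      then show ?thesis using "3.prems" r0 "3.IH"[OF r0(1)] by auto
    qed
  qed
qed auto

text \<open>One half of the row bumping lemma: in a sorted row, \<open>b\<close> enters strictly to
  the right of \<open>a\<close>, where the old entries are no smaller than the one that
  \<open>a\<close> bumped.\<close>

lemma row_insert_twice_le:
  "row_insert a r = (r', \<alpha>) \<Longrightarrow> row_insert b r' = (r'', \<beta>) \<Longrightarrow> sorted r \<Longrightarrow> a \<le> b \<Longrightarrow>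
   (case \<beta> of None \<Rightarrow> True | Some y' \<Rightarrow> (case \<alpha> of None \<Rightarrow> False | Some y \<Rightarrow> y \<le> y'))"
proof (induction r arbitrary: r' r'')
  case (Cons c r)
  then show ?case
    by (auto split: if_splits prod.splits option.splits dest: row_insert_Some)
qed auto

text \<open>The other half: \<open>b\<close> bumps \<open>a\<close> itself or an entry to its left.
  Either is at most \<open>a\<close>, hence smaller than what \<open>a\<close> bumped.\<close>

lemma row_insert_twice_less:
  "row_insert a r = (r', \<alpha>) \<Longrightarrow> row_insert b r' = (r'', \<beta>) \<Longrightarrow> b < a \<Longrightarrow>
   (\<exists>y'. \<beta> = Some y' \<and> (case \<alpha> of None \<Rightarrow> True | Some y \<Rightarrow> y' < y))"
proof (induction r arbitrary: r' r'')
  case (Cons c r)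
  then show ?case
    by (fastforce split: if_splits prod.splits option.splits dest: row_insert_Some)
qed auto

lemma strictly_below_iff:
  "strictly_below r s \<longleftrightarrow> length s \<le> length r \<and> (\<forall>j < length s. r ! j < s ! j)"
proof (induction r s rule: strictly_below.induct)
  case (3 a r b s)
  then show ?case by (auto simp: nth_Cons split: nat.splits)
qed auto

lemma tableau_partition: "tableau t \<Longrightarrow> partition (map length t)"
proof (induction t)
  case (Cons r t)
  then show ?case
  proof (cases t)
    case (Cons s t')
    then show ?thesis
      using Cons.IH Cons.prems by (auto simp: partition_def strictly_below_iff)
  qed (auto simp: partition_def)
qed (simp add: partition_def)

lemma all_nat_split: "(\<forall>i. P i) \<longleftrightarrow> P 0 \<and> (\<forall>i. P (Suc i))"
  by (metis not0_implies_Suc)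

text \<open>Links the recursive predicate, suited to insertion, with the indexed one that defines
  Schur functions. \<open>ssyt\<close> does not itself force the shape to be a partition, hence the
  second conjunct.\<close>

lemma tableau_iff: "tableau t \<longleftrightarrow> t \<in> ssyt (map length t) \<and> partition (map length t)"
proof -
  let ?col = "\<lambda>t::nat list list. \<forall>i j. Suc i < length t \<longrightarrow> j < length (t ! Suc i) \<longrightarrow>
    t ! i ! j < t ! Suc i ! j"
  have col: "?col (r # t) \<longleftrightarrow> (\<forall>j < length (hd t). r ! j < hd t ! j) \<and> ?col t"
    if "t \<noteq> []" for r t
  proof -
    have "?col (r # t) \<longleftrightarrow> (\<forall>i. Suc i < length (r # t) \<longrightarrow> (\<forall>j. j < length ((r # t) ! Suc i) \<longrightarrow>
        (r # t) ! i ! j < (r # t) ! Suc i ! j))"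
      by blast
    also have "\<dots> \<longleftrightarrow> (\<forall>j < length (hd t). r ! j < hd t ! j) \<and> ?col t"
      using that by (subst all_nat_split) (simp add: hd_conv_nth)
    finally show ?thesis .
  qed
  show ?thesis
  proof (induction t)
    case (Cons r t)
    show ?case
    proof (cases "t = []")
      case False
      then obtain s t' where t: "t = s # t'" by (cases t) auto
      have "(r # t) \<in> ssyt (map length (r # t)) \<longleftrightarrow> t \<in> ssyt (map length t) \<and>
          sorted r \<and> 0 \<notin> set r \<and> (\<forall>j < length s. r ! j < s ! j)"
        unfolding ssyt_def mem_Collect_eq col[OF False] unfolding t by auto
      moreover have "partition (map length (r # t)) \<longleftrightarrow>
          partition (map length t) \<and> r \<noteq> [] \<and> length s \<le> length r"
        by (auto simp: partition_def t)
      ultimately show ?thesis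
        using Cons.IH by (auto simp: t strictly_below_iff)
    qed (auto simp: ssyt_def partition_def)
  qed (simp add: ssyt_def partition_def)
qed

section \<open>Insertion into a tableau and its inverse\<close>

lemma tableau_insert_hd:
  "tableau_insert y s = (t, k) \<Longrightarrow>
     \<exists>t0 b. t = fst (row_insert y (case s of [] \<Rightarrow> [] | r # _ \<Rightarrow> r)) # t0"
  by (cases s) (auto split: prod.splits option.splits)

lemma tableau_ConsI:
  assumes "sorted r" "r \<noteq> []" "0 \<notin> set r" "tableau t"
    "strictly_below r (case t of [] \<Rightarrow> [] | s # _ \<Rightarrow> s)"
  shows "tableau (r # t)"
  using assms by (auto split: list.splits)

lemma tableau_ConsD:
  assumes "tableau (r # t)"
  shows "sorted r" "r \<noteq> []" "0 \<notin> set r" "tableau t"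
    "strictly_below r (case t of [] \<Rightarrow> [] | s # _ \<Rightarrow> s)"
  using assms by (auto split: list.splits)

lemma tableau_sorted_hd:
  "tableau t \<Longrightarrow> sorted (case t of [] \<Rightarrow> [] | s # _ \<Rightarrow> s)"
  by (cases t) auto

text \<open>Columns stay strict by \<open>strictly_below_row_insert\<close> along the bumping path;
  in its last row an entry is only appended. Bumped letters increase, so they remain
  positive.\<close>

lemma tableau_insert_tableau:
  assumes "tableau t" "x \<noteq> 0" "tableau_insert x t = (t', k)"
  shows "tableau t' \<and> map length t' = add_box k (map length t) \<and> k \<le> length t \<and>
    content (concat t') = Poly_Mapping.single x 1 + content (concat t)"
  using assms
proof (induction t arbitrary: x t' k)
  case Nil
  then show ?case by (auto simp: content_Cons)
next
  case (Cons r t)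
  note r = tableau_ConsD[OF Cons.prems(1)]
  obtain r' \<alpha> where r': "row_insert x r = (r', \<alpha>)" by fastforce
  show ?case
  proof (cases \<alpha>)
    case None
    then have *: "r' = r @ [x]" using row_insert_None r' by auto
    have t': "t' = r' # t" "k = 0" using Cons.prems r' None by auto
    show ?thesis
      using r strictly_below_append row_insert_sorted[OF r' r(1)] \<open>x \<noteq> 0\<close> unfolding t' *
      by (auto simp: content_append content_Cons ac_simps intro!: tableau_ConsI simp del: tableau.simps)
  next
    case (Some y)
    note r'' = r'[unfolded Some]
    obtain t0 k0 where t0: "tableau_insert y t = (t0, k0)" by fastforce
    have t': "t' = r' # t0" "k = Suc k0" using Cons.prems r'' t0 by auto
    have y: "x < y" "length r' = length r" using row_insert_Some[OF r''] by auto
    have IH: "tableau t0" "map length t0 = add_box k0 (map length t)" "k0 \<le> length t"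
        "content (concat t0) = Poly_Mapping.single y 1 + content (concat t)"
      using Cons.IH[OF r(4) _ t0] y by auto
    obtain t1 where t1: "t0 = fst (row_insert y (case t of [] \<Rightarrow> [] | r # _ \<Rightarrow> r)) # t1"
      using tableau_insert_hd[OF t0] by auto
    have "strictly_below r' (case t0 of [] \<Rightarrow> [] | s # _ \<Rightarrow> s)"
      unfolding t1 using strictly_below_row_insert[OF r'' _ r(5)]
      by (metis list.simps(5) prod.collapse)
    moreover have "r' \<noteq> []" using y r by auto
    moreover have "0 \<notin> set r'" using row_insert_set[OF r'] r \<open>x \<noteq> 0\<close> by auto
    ultimately have "tableau t'"
      unfolding t' using row_insert_sorted[OF r' r(1)] IH by (intro tableau_ConsI)
    moreover have "content r' + (Poly_Mapping.single y 1 + content (concat t)) =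
        Poly_Mapping.single x 1 + content r + content (concat t)"
      using row_insert_content[OF r''] by (simp add: add.assoc[symmetric])
    ultimately show ?thesis
      unfolding t' using IH y by (simp add: content_append add.assoc)
  qed
qed

text \<open>The index \<open>k\<close> is the row where the path ends, so both insertions stop
  together, and each bump before that is undone by \<open>row_insert_inj_Some\<close>.\<close>

lemma tableau_insert_inj:
  assumes "tableau t" "tableau s" "tableau_insert x t = (t', k)" "tableau_insert y s = (t', k)"
  shows "x = y \<and> t = s"
  using assms
proof (induction t arbitrary: x y s t' k)
  case Nil
  then show ?case
    by (cases s) (auto split: prod.splits option.splits dest!: row_insert_None)
next
  case (Cons r t)
  note r = tableau_ConsD[OF Cons.prems(1)]
  obtain r' \<alpha> where r': "row_insert x r = (r', \<alpha>)" by fastforce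
  show ?case
  proof (cases s)
    case Nil
    then show ?thesis using Cons.prems
      by (auto split: prod.splits option.splits dest!: row_insert_None)
  next
    case s: (Cons p s')
    note p = tableau_ConsD[OF Cons.prems(2)[unfolded s]]
    obtain p' \<beta> where p': "row_insert y p = (p', \<beta>)" by fastforce
    show ?thesis
    proof (cases \<alpha>)
      case None
      then show ?thesis using Cons.prems r' p' s
        by (auto split: prod.splits option.splits dest!: row_insert_None)
    next
      case (Some a)
      obtain t0 k0 where t0: "tableau_insert a t = (t0, k0)" by fastforce
      have t': "t' = r' # t0" "k = Suc k0" using Cons.prems r' Some t0 by auto
      then obtain b where b: "\<beta> = Some b"
        using Cons.prems(4) s p' by (auto split: option.splits)
      have *: "p' = r'" "tableau_insert b s' = (t0, k0)"
        using Cons.prems(4) s p' b t' by (auto split: prod.splits)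
      then have "a = b \<and> t = s'" using Cons.IH[OF r(4) p(4) t0] by simp
      then show ?thesis using row_insert_inj_Some[of x r r' a y p] r' p' Some b * r p s by auto
    qed
  qed
qed

lemma strictly_below_butlast:
  "strictly_below (r @ [x]) s \<Longrightarrow> length s \<le> length r \<Longrightarrow> strictly_below r s"
  by (auto simp: strictly_below_iff nth_append)

text \<open>Remove the last entry of row \<open>k\<close> and bump it back up through the rows
  above.\<close>

lemma tableau_uninsert:
  assumes "tableau t'" "map length t' = add_box k \<mu>" "partition \<mu>" "k \<le> length \<mu>"
  shows "\<exists>x t. x \<noteq> 0 \<and> tableau t \<and> map length t = \<mu> \<and> tableau_insert x t = (t', k)"
  using assms
proof (induction k arbitrary: t' \<mu>)
  case 0
  show ?case
  proof (cases \<mu>)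
    case Nil
    then obtain r where t': "t' = [r]" "length r = 1" using 0 by auto
    then obtain x where "r = [x]" by (auto simp: length_Suc_conv)
    then show ?thesis using 0 t' Nil by (intro exI[of _ x] exI[of _ "[]"]) auto
  next
    case (Cons m \<mu>')
    then obtain r' t where t': "t' = r' # t" "length r' = Suc m" "map length t = \<mu>'"
      using 0 by auto
    then obtain r x where r': "r' = r @ [x]" by (cases r' rule: rev_cases) auto
    note D = tableau_ConsD[OF 0(1)[unfolded t']]
    have m: "length r = m" "m \<noteq> 0" using t' r' 0(3) Cons by (auto simp: partition_def)
    \<comment> \<open>As \<mu> is a partition, the next row still fits under the shortened
      one.\<close>
    have "length (case t of [] \<Rightarrow> [] | s # _ \<Rightarrow> s) \<le> length r"
      using t' m 0(3) Cons by (auto simp: partition_def split: list.splits)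
    then have "strictly_below r (case t of [] \<Rightarrow> [] | s # _ \<Rightarrow> s)"
      using D(5) r' strictly_below_butlast by blast
    then have "tableau (r # t)"
      using D m by (intro tableau_ConsI) (auto simp: r' sorted_append)
    moreover have "tableau_insert x (r # t) = (t', 0)"
      using row_insert_total_None[of r x] D(1) t' r' by simp
    ultimately show ?thesis
      using D r' m t' Cons by (intro exI[of _ x] exI[of _ "r # t"]) auto
  qed
next
  case (Suc k)
  then obtain m \<mu>' where \<mu>: "\<mu> = m # \<mu>'" by (cases \<mu>) auto
  then obtain r' t0 where t': "t' = r' # t0" "length r' = m" "map length t0 = add_box k \<mu>'"
    using Suc.prems by auto
  note D = tableau_ConsD[OF Suc.prems(1)[unfolded t']]
  have "partition \<mu>'" "k \<le> length \<mu>'" using \<mu> Suc.prems by (auto simp: partition_def)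
  then obtain y t where yt: "y \<noteq> 0" "tableau t" "map length t = \<mu>'" "tableau_insert y t = (t0, k)"
    using Suc.IH[OF D(4) t'(3)] by auto
  let ?s = "case t of [] \<Rightarrow> [] | r # _ \<Rightarrow> r"
  obtain s' \<beta> where s': "row_insert y ?s = (s', \<beta>)" by fastforce
  obtain t1 where t1: "t0 = s' # t1"
    using tableau_insert_hd[OF yt(4)] s' by auto
  have below: "strictly_below r' s'" using D(5) t1 by simp
  \<comment> \<open>Some entry of the sorted row \<open>r'\<close> is smaller than \<open>y\<close>,
    hence so is its first entry.\<close>
  obtain a r'' where ar: "r' = a # r''" "a < y"
    using strictly_below_row_insert_ex[OF s' below] D(1) by (cases r') force+
  obtain x r where xr: "sorted r" "row_insert x r = (r', Some y)" "x \<in> set r'"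
    using row_insert_ex[of a r'' y] D(1) ar by auto
  have "strictly_below r ?s"
    using strictly_below_row_uninsert[OF xr(2) s' xr(1) tableau_sorted_hd[OF yt(2)] below] .
  moreover have r: "length r = length r'" "set r \<subseteq> insert y (set r')"
    using row_insert_Some[OF xr(2)] by auto
  ultimately have "tableau (r # t)"
    using D xr yt by (intro tableau_ConsI) auto
  moreover have "tableau_insert x (r # t) = (t', Suc k)"
    using xr yt t' by simp
  moreover have "x \<noteq> 0" using xr D by metis
  ultimately show ?case
    using r t' \<mu> yt by (intro exI[of _ x] exI[of _ "r # t"]) auto
qed

text \<open>By the two halves of the row bumping lemma, the comparison of the two letters is
  inherited by the letters they bump, and it decides which path ends lower.\<close>

lemma tableau_insert_twice:
  assumes "tableau_insert a t = (t', k)" "tableau_insert b t' = (t'', k')" "tableau t"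
  shows "k < k' \<longleftrightarrow> b < a"
  using assms
proof (induction t arbitrary: a b t' t'' k k')
  case Nil
  then show ?case by (auto split: if_splits)
next
  case (Cons r t)
  note D = tableau_ConsD[OF Cons.prems(3)]
  obtain r' \<alpha> where r': "row_insert a r = (r', \<alpha>)" by fastforce
  obtain r'' \<beta> where r'': "row_insert b r' = (r'', \<beta>)" by fastforce
  note le = row_insert_twice_le[OF r' r'' D(1)] and less = row_insert_twice_less[OF r' r'']
  show ?case
  proof (cases \<alpha>)
    case None
    then show ?thesis using Cons.prems r' r'' le less
      by (cases "b < a") (auto split: option.splits prod.splits)
  next
    case (Some y)
    obtain t0 k0 where t0: "tableau_insert y t = (t0, k0)" by fastforce
    have t': "t' = r' # t0" "k = Suc k0" using Cons.prems r' Some t0 by auto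
    show ?thesis
    proof (cases \<beta>)
      case None
      then show ?thesis using Cons.prems Some t' r' r'' le less
        by (cases "b < a") (auto split: option.splits prod.splits)
    next
      case b: (Some z)
      obtain t1 k1 where t1: "tableau_insert z t0 = (t1, k1)" by fastforce
      have "k' = Suc k1" using Cons.prems t' r'' b t1 by auto
      then show ?thesis using Cons.IH[OF t0 t1 D(4)] le less t' Some b
        by (cases "b < a") auto
    qed
  qed
qed

section \<open>The bijection between words and pairs of tableaux of equal shape\<close>

lemma rsk_correct:
  assumes "0 \<notin> set w" "rsk w = (t, q)"
  shows "tableau t \<and> lattice_word q \<and> shape_of q = map length t \<and> content (concat t) = content w \<and>
    adj (>) q = adj (<) w \<and> length q = length w"
  using assms
proof (induction w arbitrary: t q)
  case (Cons x w)
  obtain s p where s: "rsk w = (s, p)" by fastforce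
  obtain k where k: "tableau_insert x s = (t, k)" "q = k # p"
    using Cons.prems s by (auto split: prod.splits)
  have IH: "tableau s" "lattice_word p" "shape_of p = map length s"
      "content (concat s) = content w" "adj (>) p = adj (<) w" "length p = length w"
    using Cons.IH[OF _ s] Cons.prems by auto
  note ins = tableau_insert_tableau[OF IH(1) _ k(1)]
  have "adj (>) q = adj (<) (x # w)"
  proof (cases w)
    case (Cons y w')
    obtain s' p' where s': "rsk w' = (s', p')" by fastforce
    obtain j where j: "tableau_insert y s' = (s, j)" "p = j # p'"
      using s Cons s' by (auto split: prod.splits)
    \<comment> \<open>The induction hypothesis covers \<open>w\<close> but not its tail
      \<open>w'\<close>, so this takes an induction of its own.\<close>
    have "tableau s'"
    proof -
      have "0 \<notin> set w'" using Cons.prems Cons by auto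
      then show ?thesis using s'
      proof (induction w' arbitrary: s' p')
        case (Cons z v)
        obtain a b where "rsk v = (a, b)" by fastforce
        then show ?case using Cons tableau_insert_tableau[of a z]
          by (auto split: prod.splits)
      qed auto
    qed
    \<comment> \<open>Of the two first letters \<open>y\<close> is inserted before \<open>x\<close>,
      so a strict rise of the word is a step to a lower row of the tableau.\<close>
    then have "j < k \<longleftrightarrow> x < y"
      using tableau_insert_twice[OF j(1) k(1)] by blast
    then show ?thesis using IH(5) k j Cons by auto
  qed (use k IH in auto)
  then show ?case
    using ins tableau_partition[of t] Cons.prems IH k by (auto simp: content_Cons)
qed auto

lemma rsk_inj:
  assumes "0 \<notin> set w" "0 \<notin> set w'" "rsk w = rsk w'" shows "w = w'"
  using assms
proof (induction w arbitrary: w')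
  case Nil
  then show ?case by (cases w') (auto split: prod.splits)
next
  case (Cons x w)
  obtain s p where s: "rsk w = (s, p)" by fastforce
  obtain y v where w': "w' = y # v"
    using Cons.prems by (cases w') (auto split: prod.splits)
  obtain s' p' where s': "rsk v = (s', p')" by fastforce
  have *: "tableau_insert x s = tableau_insert y s'" "p = p'"
    using Cons.prems s s' w' by (auto split: prod.splits)
  obtain t k where t: "tableau_insert x s = (t, k)" by fastforce
  have "tableau s" "tableau s'"
    using rsk_correct[OF _ s] rsk_correct[OF _ s'] Cons.prems w' by auto
  then have "x = y \<and> s = s'" using tableau_insert_inj t * by metis
  then show ?case using Cons.IH[of v] Cons.prems w' s s' * by auto
qed

lemma rsk_surj:
  assumes "tableau t" "lattice_word q" "shape_of q = map length t"
  shows "\<exists>w. 0 \<notin> set w \<and> rsk w = (t, q)"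
  using assms
proof (induction q arbitrary: t)
  case Nil
  then show ?case by (intro exI[of _ "[]"]) auto
next
  case (Cons k q)
  have "partition (shape_of q)"
    using Cons.prems by (cases q) (auto simp: partition_def)
  then obtain x s where x: "x \<noteq> 0" "tableau s" "map length s = shape_of q" "tableau_insert x s = (t, k)"
    using tableau_uninsert[OF Cons.prems(1), of k "shape_of q"] Cons.prems by auto
  then obtain w where "0 \<notin> set w" "rsk w = (s, q)"
    using Cons.IH[of s] Cons.prems by auto
  then show ?case using x by (intro exI[of _ "x # w"]) auto
qed

section \<open>Linearizing the functional equation\<close>

text \<open>Here \<open>g i\<close> stands for the series of trees with root label \<open>i\<close>, \<open>y i\<close> for \<open>z x\<^sub>i\<close> (\<open>z\<close> marks size), and \<open>u i\<close> for
  \<open>1 / q i\<close>.  The recursion \<open>S (i - 1) \<mapsto> S i\<close> is a fractional linear map, and \<open>S i / q i\<close> is the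
  projective coordinate in which it becomes affine.\<close>

lemma riccati_partial_sums:
  fixes g V u y p q S :: "nat \<Rightarrow> 'a::comm_ring_1" and l lb r rb :: 'a
  assumes S: "\<And>i. S i = sum g {1..i}"
    and p: "\<And>i. p i = 1 + lb * S i + l * (S N - S i)"
    and q: "\<And>i. q i = 1 + rb * (S N - S i) + r * S i"
    and g: "\<And>i. i \<in> {1..N} \<Longrightarrow> g i = y i * p i * q (i - 1)"
    and u: "\<And>i. q i * u i = 1"
    and V: "\<And>i. V i = y i * (1 + r * S N) * (1 + rb * S N) * p i * u i"
    and i: "i \<le> N"
  shows "sum V {1..i} = S i * (1 + r * S N) * u i"
  using i
proof (induction i)
  case 0
  then show ?case by (simp add: S)
next
  case (Suc i)
  have Si: "S (Suc i) = S i + y (Suc i) * p (Suc i) * q i"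
    using g[of "Suc i"] Suc.prems by (simp add: S)
  \<comment> \<open>Since \<open>q i = (1 + rb * S N) - (rb - r) * S i\<close>, the terms in
    \<open>S i * S (Suc i)\<close> cancel.\<close>
  have "S (Suc i) * q i - S i * q (Suc i) = (S (Suc i) - S i) * (1 + rb * S N)"
    by (simp add: q algebra_simps)
  also have "S (Suc i) - S i = y (Suc i) * p (Suc i) * q i"
    by (simp add: Si)
  finally have main: "S (Suc i) * q i - S i * q (Suc i) =
    y (Suc i) * p (Suc i) * q i * (1 + rb * S N)" .
  \<comment> \<open>Division by \<open>q i * q (Suc i)\<close> makes this the increment of
    \<open>S i * u i\<close>, so that the sums of \<open>V\<close> telescope.\<close>
  have "S (Suc i) * u (Suc i) - S i * u i =
      S (Suc i) * u (Suc i) * (q i * u i) - S i * u i * (q (Suc i) * u (Suc i))"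
    by (simp only: u mult_1_right)
  also have "\<dots> = (S (Suc i) * q i - S i * q (Suc i)) * u i * u (Suc i)"
    by (simp add: algebra_simps)
  also have "\<dots> = y (Suc i) * p (Suc i) * (1 + rb * S N) * u (Suc i) * (q i * u i)"
    unfolding main by (simp only: ac_simps)
  finally have "S (Suc i) * u (Suc i) = S i * u i + y (Suc i) * p (Suc i) * (1 + rb * S N) * u (Suc i)"
    by (simp add: u diff_eq_eq add.commute)
  then have "(S (Suc i) * u (Suc i)) * (1 + r * S N) =
      (S i * u i + y (Suc i) * p (Suc i) * (1 + rb * S N) * u (Suc i)) * (1 + r * S N)"
    by simp
  then have "S (Suc i) * (1 + r * S N) * u (Suc i) = S i * (1 + r * S N) * u i + V (Suc i)"
    unfolding V distrib_right[of "S i * u i"] by (simp only: ac_simps)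
  then show ?case using Suc by simp
qed

lemma riccati_linear_system:
  fixes g V u y p q S :: "nat \<Rightarrow> 'a::comm_ring_1" and l lb r rb :: 'a
  assumes S: "\<And>i. S i = sum g {1..i}"
    and p: "\<And>i. p i = 1 + lb * S i + l * (S N - S i)"
    and q: "\<And>i. q i = 1 + rb * (S N - S i) + r * S i"
    and g: "\<And>i. i \<in> {1..N} \<Longrightarrow> g i = y i * p i * q (i - 1)"
    and u: "\<And>i. q i * u i = 1"
    and V: "\<And>i. V i = y i * (1 + r * S N) * (1 + rb * S N) * p i * u i"
    and a: "a = rb + lb + rb * lb * S N" and b: "b = r + l + r * l * S N"
  shows "sum V {1..N} = S N"
    and "i \<in> {1..N} \<Longrightarrow> V i = y i * (1 + (\<Sum>j\<in>{1..N}. (if i < j then b else a) * V j))"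
proof -
  note psum = riccati_partial_sums[OF S p q g u V]
  \<comment> \<open>For \<open>i = N\<close> the factor \<open>1 + r * S N\<close> is
    \<open>q N\<close>, which \<open>u N\<close> cancels.\<close>
  show total: "sum V {1..N} = S N"
    using psum[of N] u[of N] by (simp add: q mult.assoc)
  assume i: "i \<in> {1..N}"
  \<comment> \<open>Equal letters get weight \<open>a\<close>, so the correction from
    \<open>b\<close> to \<open>a\<close> runs over the whole prefix \<open>{1..i}\<close>, whose sum
    is known.\<close>
  have "(\<Sum>j\<in>{1..N}. (if i < j then b else a) * V j) =
      (\<Sum>j\<in>{1..N}. b * V j) + (\<Sum>j\<in>{1..N}. if j \<le> i then (a - b) * V j else 0)"
    unfolding sum.distrib[symmetric] by (intro sum.cong) (auto simp: algebra_simps)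
  also have "(\<Sum>j\<in>{1..N}. if j \<le> i then (a - b) * V j else 0) = (\<Sum>j\<in>{1..i}. (a - b) * V j)"
    using i by (intro sum.mono_neutral_cong_right) auto
  finally have sum: "1 + (\<Sum>j\<in>{1..N}. (if i < j then b else a) * V j) =
      1 + b * S N + (a - b) * (S i * (1 + r * S N) * u i)"
    using psum[of i] i total by (simp add: sum_distrib_left[symmetric])
  \<comment> \<open>Both sides are affine in \<open>S i\<close>. They agree at
    \<open>S i = 0\<close> and \<open>S i = S N\<close> because
    \<open>1 + b * S N = (1 + r * S N) * (1 + l * S N)\<close> and
    \<open>1 + a * S N = (1 + rb * S N) * (1 + lb * S N)\<close>.\<close>
  have "(1 + b * S N) * q i + (a - b) * S i * (1 + r * S N) = (1 + r * S N) * (1 + rb * S N) * p i"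
    by (simp add: a b q p algebra_simps)
  then have "(1 + b * S N) * (q i * u i) + (a - b) * (S i * (1 + r * S N) * u i) =
      (1 + r * S N) * (1 + rb * S N) * p i * u i"
    by (simp only: mult.assoc[symmetric] distrib_right[symmetric])
  then have "1 + b * S N + (a - b) * (S i * (1 + r * S N) * u i) =
      (1 + r * S N) * (1 + rb * S N) * p i * u i"
    by (simp add: u)
  then show "V i = y i * (1 + (\<Sum>j\<in>{1..N}. (if i < j then b else a) * V j))"
    unfolding sum by (simp add: V mult.assoc)
qed

section \<open>Words as the solution of the linear system\<close>

definition words :: "nat \<Rightarrow> nat \<Rightarrow> nat list set" where
  "words N n = {w. length w = n \<and> set w \<subseteq> {1..N}}"

lemma finite_words [simp]: "finite (words N n)"
proof -
  have "words N n = {w. set w \<subseteq> {1..N} \<and> length w = n}" by (auto simp: words_def)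
  then show ?thesis by (simp add: finite_lists_length_eq)
qed

text \<open>In \<open>adj (<) w\<close> the value \<open>True\<close> marks a strict rise, which is
  a descent of \<open>w\<close> read from right to left; hence it gets \<open>b\<close>.\<close>

definition descent_prod :: "'a::comm_monoid_mult \<Rightarrow> 'a \<Rightarrow> bool list \<Rightarrow> 'a" where
  "descent_prod a b D = prod_list (map (\<lambda>d. if d then b else a) D)"

lemma descent_prod_Nil [simp]: "descent_prod a b [] = 1"
  and descent_prod_Cons [simp]:
    "descent_prod a b (d # D) = (if d then b else a) * descent_prod a b D"
  by (simp_all add: descent_prod_def)

lemma sum_words_Suc: "(\<Sum>w\<in>words N (Suc n). f w) = (\<Sum>i\<in>{1..N}. \<Sum>w\<in>words N n. f (i # w))"
proof -
  have "words N (Suc n) = (\<lambda>(i, w). i # w) ` ({1..N} \<times> words N n)"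
    by (auto simp: words_def length_Suc_conv image_iff)
  moreover have "inj_on (\<lambda>(i, w). i # w) ({1..N} \<times> words N n)"
    by (auto simp: inj_on_def)
  ultimately show ?thesis
    by (simp add: sum.reindex sum.cartesian_product case_prod_unfold)
qed

lemma words_0 [simp]: "words N 0 = {[]}"
  by (auto simp: words_def)

text \<open>Substituting the system into itself \<open>n\<close> times gives the truncated Neumann
  series, with one term for each walk through the letters. The remainder keeps a factor
  \<open>z ^ n\<close>, so no convergence is involved.\<close>

lemma words_linear_system:
  fixes V x :: "nat \<Rightarrow> 'a::comm_ring_1" and a b z :: 'a
  assumes V: "\<And>i. i \<in> {1..N} \<Longrightarrow> V i = z * x i * (1 + (\<Sum>j\<in>{1..N}. (if i < j then b else a) * V j))"
  shows "\<exists>E. sum V {1..N} =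
    (\<Sum>k<n. z ^ Suc k * (\<Sum>w\<in>words N (Suc k). prod_list (map x w) * descent_prod a b (adj (<) w)))
      + z ^ n * E"
proof -
  \<comment> \<open>The part of the series from words of length \<open>k + 1\<close> that begin with
    \<open>i\<close>.\<close>
  define U where "U k i = (\<Sum>w\<in>words N k. prod_list (map x (i # w)) * descent_prod a b (adj (<) (i # w)))"
    for k i
  have U_Suc: "U (Suc k) i = x i * (\<Sum>j\<in>{1..N}. (if i < j then b else a) * U k j)" for k i
    by (simp add: U_def sum_words_Suc sum_distrib_left ac_simps)
  have "\<exists>E. \<forall>i\<in>{1..N}. V i = (\<Sum>k<n. z ^ Suc k * U k i) + z ^ n * E i"
  proof (induction n)
    case 0
    show ?case by (intro exI[of _ V]) auto
  next
    case (Suc n)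
    then obtain E where E: "\<forall>i\<in>{1..N}. V i = (\<Sum>k<n. z ^ Suc k * U k i) + z ^ n * E i"
      ..
    let ?m = "\<lambda>i j. if i < j then b else a"
    have "V i = (\<Sum>k<Suc n. z ^ Suc k * U k i) + z ^ Suc n * (x i * (\<Sum>j\<in>{1..N}. ?m i j * E j))"
      if i: "i \<in> {1..N}" for i
    proof -
      have "(\<Sum>j\<in>{1..N}. ?m i j * V j) =
          (\<Sum>j\<in>{1..N}. (\<Sum>k<n. z ^ Suc k * (?m i j * U k j)) + z ^ n * (?m i j * E j))"
        using E by (intro sum.cong refl) (simp add: sum_distrib_left algebra_simps)
      also have "\<dots> = (\<Sum>k<n. z ^ Suc k * (\<Sum>j\<in>{1..N}. ?m i j * U k j)) +
          z ^ n * (\<Sum>j\<in>{1..N}. ?m i j * E j)"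
        unfolding sum.distrib sum_distrib_left by (subst sum.swap) simp
      finally have "V i = z * x i + (\<Sum>k<n. z ^ Suc (Suc k) * (x i * (\<Sum>j\<in>{1..N}. ?m i j * U k j))) +
          z ^ Suc n * (x i * (\<Sum>j\<in>{1..N}. ?m i j * E j))"
        by (subst V[OF i]) (simp add: algebra_simps sum_distrib_left)
      moreover have "U 0 i = x i" by (simp add: U_def)
      ultimately show ?thesis
        by (simp only: U_Suc[symmetric] sum.lessThan_Suc_shift) simp
    qed
    then show ?case
      by (intro exI[of _ "\<lambda>i. x i * (\<Sum>j\<in>{1..N}. ?m i j * E j)"] ballI)
  qed
  then obtain E where E: "\<forall>i\<in>{1..N}. V i = (\<Sum>k<n. z ^ Suc k * U k i) + z ^ n * E i"
    ..
  have "sum V {1..N} = (\<Sum>k<n. z ^ Suc k * (\<Sum>i\<in>{1..N}. U k i)) + z ^ n * sum E {1..N}"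
    using E by (simp add: sum.distrib sum_distrib_left) (rule sum.swap)
  then show ?thesis by (auto simp: U_def sum_words_Suc)
qed

section \<open>Series that depend on descents only, with nonnegative coefficients\<close>

lemma nat_coeff_polys_0 [simp]: "0 \<in> nat_coeff_polys"
  and nat_coeff_polys_1 [simp]: "1 \<in> nat_coeff_polys"
  and nat_coeff_polys_param_var [simp]: "param_var v \<in> nat_coeff_polys"
  by (auto simp: nat_coeff_polys_def param_var_def lookup_single lookup_one when_def)

lemma nat_coeff_polys_add: "p \<in> nat_coeff_polys \<Longrightarrow> q \<in> nat_coeff_polys \<Longrightarrow> p + q \<in> nat_coeff_polys"
  by (auto simp: nat_coeff_polys_def lookup_add)

lemma nat_coeff_polys_sum: "(\<And>i. i \<in> I \<Longrightarrow> f i \<in> nat_coeff_polys) \<Longrightarrow> sum f I \<in> nat_coeff_polys"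
  by (induction I rule: infinite_finite_induct) (auto intro: nat_coeff_polys_add)

lemma Nats_Sum_any: "(\<And>i. f i \<in> \<nat>) \<Longrightarrow> Sum_any f \<in> (\<nat> :: 'a::semiring_1 set)"
proof -
  assume f: "\<And>i. f i \<in> \<nat>"
  have "sum f I \<in> \<nat>" for I
    using f by (induction I rule: infinite_finite_induct) auto
  then show ?thesis by (simp add: Sum_any.expand_set)
qed

lemma nat_coeff_polys_mult: "p \<in> nat_coeff_polys \<Longrightarrow> q \<in> nat_coeff_polys \<Longrightarrow> p * q \<in> nat_coeff_polys"
  by (auto simp: nat_coeff_polys_def lookup_mult when_def intro!: Nats_Sum_any Nats_mult)

type_synonym x_poly = "(nat \<Rightarrow>\<^sub>0 nat) \<Rightarrow>\<^sub>0 coeff_poly"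

abbreviation x_monom :: "(nat \<Rightarrow>\<^sub>0 nat) \<Rightarrow> coeff_poly \<Rightarrow> x_poly" where
  "x_monom \<equiv> Poly_Mapping.single"

text \<open>The argument \<open>N\<close> bounds the labels; the coefficients \<open>c\<close> must not depend on it.  As \<open>c\<close>
  sees only the descent pattern of a word, this is positivity in ribbon Schur functions.\<close>

definition descent_positive :: "nat \<Rightarrow> (nat \<Rightarrow> x_poly) \<Rightarrow> bool" where
  "descent_positive n f \<longleftrightarrow> (\<exists>c. (\<forall>D. c D \<in> nat_coeff_polys) \<and>
     (\<forall>N. f N = (\<Sum>w\<in>words N n. x_monom (content w) (c (adj (<) w)))))"

lemma descent_positive_0: "descent_positive n (\<lambda>_. 0)"
  unfolding descent_positive_def by (intro exI[of _ "\<lambda>_. 0"]) auto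

lemma descent_positive_const: "p \<in> nat_coeff_polys \<Longrightarrow> descent_positive 0 (\<lambda>_. x_monom 0 p)"
  unfolding descent_positive_def by (intro exI[of _ "\<lambda>_. p"]) auto

lemma descent_positive_add:
  assumes "descent_positive n f" "descent_positive n g"
  shows "descent_positive n (\<lambda>N. f N + g N)"
proof -
  obtain c d where "\<forall>D. c D \<in> nat_coeff_polys" "\<forall>D. d D \<in> nat_coeff_polys"
    "\<forall>N. f N = (\<Sum>w\<in>words N n. x_monom (content w) (c (adj (<) w)))"
    "\<forall>N. g N = (\<Sum>w\<in>words N n. x_monom (content w) (d (adj (<) w)))"
    using assms by (auto simp: descent_positive_def)
  then show ?thesis unfolding descent_positive_def
    by (intro exI[of _ "\<lambda>D. c D + d D"])
       (auto simp: nat_coeff_polys_add single_add sum.distrib)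
qed

lemma descent_positive_sum:
  "(\<And>i. i \<in> I \<Longrightarrow> descent_positive n (f i)) \<Longrightarrow> descent_positive n (\<lambda>N. \<Sum>i\<in>I. f i N)"
  by (induction I rule: infinite_finite_induct)
     (auto simp: descent_positive_0 intro: descent_positive_add)

section \<open>Products by concatenation of words\<close>

lemma adj_take: "adj R (take n w) = take (n - Suc 0) (adj R w)"
proof (induction R w arbitrary: n rule: adj.induct)
  case (1 R x y w)
  show ?case
  proof (cases n)
    case (Suc m)
    then show ?thesis using 1[of m] by (cases m) auto
  qed auto
qed (auto simp: take_Cons split: nat.splits)

lemma adj_drop: "adj R (drop n w) = drop n (adj R w)"
proof (induction R w arbitrary: n rule: adj.induct)
  case (1 R x y w)
  then show ?case by (cases n) auto
qed (auto simp: drop_Cons split: nat.splits)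

lemma length_adj: "length (adj R w) = length w - 1"
  by (induction R w rule: adj.induct) auto

lemma sum_words_add:
  "(\<Sum>w\<in>words N (i + j). f w) = (\<Sum>u\<in>words N i. \<Sum>v\<in>words N j. f (u @ v))"
proof -
  have "(\<Sum>w\<in>words N (i + j). f w) = (\<Sum>(u, v)\<in>words N i \<times> words N j. f (u @ v))"
    by (rule sum.reindex_bij_witness[of _ "\<lambda>(u, v). u @ v" "\<lambda>w. (take i w, drop i w)"])
       (auto simp: words_def dest: in_set_takeD in_set_dropD)
  then show ?thesis by (simp add: sum.cartesian_product)
qed

text \<open>The patterns of both factors can be read off from that of the concatenation: entry
  \<open>i - 1\<close> belongs to the junction and is ignored. This is the rule that a product of
  two ribbon Schur functions is a sum of ribbon Schur functions.\<close>

lemma descent_positive_mult: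
  assumes "descent_positive i f" "descent_positive j g"
  shows "descent_positive (i + j) (\<lambda>N. f N * g N)"
proof -
  obtain c d where cd: "\<forall>D. c D \<in> nat_coeff_polys" "\<forall>D. d D \<in> nat_coeff_polys"
    "\<And>N. f N = (\<Sum>w\<in>words N i. x_monom (content w) (c (adj (<) w)))"
    "\<And>N. g N = (\<Sum>w\<in>words N j. x_monom (content w) (d (adj (<) w)))"
    using assms by (auto simp: descent_positive_def)
  have "f N * g N = (\<Sum>w\<in>words N (i + j). x_monom (content w)
      (c (take (i - 1) (adj (<) w)) * d (drop i (adj (<) w))))" for N
    unfolding cd sum_words_add sum_product
    by (intro sum.cong refl)
       (auto simp: mult_single content_append adj_take[symmetric] adj_drop[symmetric] words_def)
  then show ?thesis
    unfolding descent_positive_def using cd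
    by (intro exI[of _ "\<lambda>D. c (take (i - 1) D) * d (drop i D)"]) (auto simp: nat_coeff_polys_mult)
qed

text \<open>The bound \<open>n\<close> serves a strong induction in which only lower coefficients
  are known to be positive. The power of the series variable equals the word length, so products
  respect the bound.\<close>

definition descent_positive_upto :: "nat \<Rightarrow> (nat \<Rightarrow> x_poly fps) \<Rightarrow> bool" where
  "descent_positive_upto n F \<longleftrightarrow> (\<forall>m\<le>n. descent_positive m (\<lambda>N. F N $ m))"

lemma descent_positive_upto_const:
  assumes "p \<in> nat_coeff_polys"
  shows "descent_positive_upto n (\<lambda>_. fps_const (x_monom 0 p))"
  using descent_positive_const[OF assms] descent_positive_0
  by (auto simp: descent_positive_upto_def)

lemma descent_positive_upto_add:
  "descent_positive_upto n F \<Longrightarrow> descent_positive_upto n H \<Longrightarrow>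
    descent_positive_upto n (\<lambda>N. F N + H N)"
  by (auto simp: descent_positive_upto_def intro: descent_positive_add)

lemma descent_positive_upto_mult:
  assumes "descent_positive_upto n F" "descent_positive_upto n H"
  shows "descent_positive_upto n (\<lambda>N. F N * H N)"
  unfolding descent_positive_upto_def
proof (intro allI impI)
  fix m assume m: "m \<le> n"
  have "descent_positive m (\<lambda>N. F N $ i * H N $ (m - i))" if "i \<in> {0..m}" for i
    using descent_positive_mult[of i _ "m - i"] assms m that
    by (auto simp: descent_positive_upto_def)
  then show "descent_positive m (\<lambda>N. (F N * H N) $ m)"
    unfolding fps_mult_nth by (rule descent_positive_sum)
qed

lemma descent_positive_upto_descent_prod:
  assumes "descent_positive_upto n F" "descent_positive_upto n H"
  shows "descent_positive_upto n (\<lambda>N. descent_prod (F N) (H N) D)"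
proof (induction D)
  case Nil
  then show ?case
    using descent_positive_upto_const[of 1] by (simp add: single_one)
next
  case (Cons d D)
  then show ?case
    using assms by (cases d) (auto intro!: descent_positive_upto_mult)
qed

text \<open>For \<open>D\<close> of length \<open>n - 1\<close> this is the ribbon Schur polynomial
  of \<open>D\<close> in \<open>N\<close> variables, with words read from right to left.\<close>

lemma descent_positive_ribbon:
  "descent_positive n (\<lambda>N. \<Sum>w | w \<in> words N n \<and> adj (<) w = D. x_monom (content w) 1)"
  unfolding descent_positive_def
proof (intro exI conjI allI)
  show "(if D' = D then 1 else 0) \<in> nat_coeff_polys" for D' by simp
  show "(\<Sum>w | w \<in> words N n \<and> adj (<) w = D. x_monom (content w) 1) =
      (\<Sum>w\<in>words N n. x_monom (content w) (if adj (<) w = D then 1 else 0))" for N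
    by (intro sum.mono_neutral_cong_left) auto
qed

lemma finite_bool_lists: "finite {D :: bool list. length D = n}"
  using finite_lists_length_eq[of "UNIV :: bool set" n] by simp

text \<open>Words are grouped by their pattern \<open>D\<close>, on which alone the second factor
  depends. The patterns form a finite set independent of \<open>N\<close>, so the coefficients stay
  independent of \<open>N\<close> as well.\<close>

lemma descent_positive_word_series:
  assumes "descent_positive_upto j F" "descent_positive_upto j H"
  shows "descent_positive (n + j) (\<lambda>N. (\<Sum>w\<in>words N n.
    fps_const (x_monom (content w) 1) * descent_prod (F N) (H N) (adj (<) w)) $ j)"
proof -
  let ?R = "\<lambda>D N. \<Sum>w | w \<in> words N n \<and> adj (<) w = D. x_monom (content w) 1"
  let ?B = "{D :: bool list. length D = n - 1}"
  have "(\<Sum>w\<in>words N n. fps_const (x_monom (content w) 1) * descent_prod (F N) (H N) (adj (<) w)) $ j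
     = (\<Sum>D\<in>?B. ?R D N * descent_prod (F N) (H N) D $ j)" for N
  proof -
    have "(\<Sum>w\<in>words N n. fps_const (x_monom (content w) 1) * descent_prod (F N) (H N) (adj (<) w)) $ j
       = (\<Sum>w\<in>words N n. x_monom (content w) 1 * descent_prod (F N) (H N) (adj (<) w) $ j)"
      by (simp add: fps_sum_nth)
    also have "\<dots> = (\<Sum>D\<in>?B. \<Sum>w | w \<in> words N n \<and> adj (<) w = D.
        x_monom (content w) 1 * descent_prod (F N) (H N) (adj (<) w) $ j)"
    proof (rule sum.group[symmetric])
      show "(\<lambda>w. adj (<) w) ` words N n \<subseteq> ?B" by (auto simp: length_adj words_def)
    qed (simp_all add: finite_bool_lists)
    finally show ?thesis by (simp add: sum_distrib_right)
  qed
  moreover have "descent_positive j (\<lambda>N. descent_prod (F N) (H N) D $ j)" for D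
    using descent_positive_upto_descent_prod[OF assms, of D] by (auto simp: descent_positive_upto_def)
  ultimately show ?thesis
    by (simp add: descent_positive_sum descent_positive_mult descent_positive_ribbon)
qed

section \<open>Trees with bounded labels\<close>

definition trees :: "nat \<Rightarrow> nat \<Rightarrow> nat tree set" where
  "trees N n = {T. size T = n \<and> set_tree T \<subseteq> {1..N}}"

definition rooted_trees :: "nat \<Rightarrow> nat \<Rightarrow> nat \<Rightarrow> nat tree set" where
  "rooted_trees N n i = {T \<in> trees N n. \<exists>l r. T = Node l i r}"

definition tree_monom :: "nat tree \<Rightarrow> x_poly" where
  "tree_monom T = x_monom (content (inorder T)) (tree_weight T)"

definition root_series :: "nat \<Rightarrow> nat \<Rightarrow> x_poly fps" where
  "root_series N i = Abs_fps (\<lambda>n. \<Sum>T\<in>rooted_trees N n i. tree_monom T)"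

definition left_edge :: "nat \<Rightarrow> nat tree \<Rightarrow> coeff_poly" where
  "left_edge i T = (case T of Leaf \<Rightarrow> 1 | Node _ v _ \<Rightarrow>
     if v \<le> i then param_var Lam_bar else param_var Lam)"

definition right_edge :: "nat \<Rightarrow> nat tree \<Rightarrow> coeff_poly" where
  "right_edge i T = (case T of Leaf \<Rightarrow> 1 | Node _ v _ \<Rightarrow>
     if i \<le> v then param_var Rho_bar else param_var Rho)"

lemma finite_trees [simp]: "finite (trees N n)"
  by (rule finite_subset[OF _ finite_trees_bounded[of "{1..N}" n]]) (auto simp: trees_def)

lemma finite_rooted_trees [simp]: "finite (rooted_trees N n i)"
  by (simp add: rooted_trees_def)

lemma trees_0 [simp]: "trees N 0 = {Leaf}"
  by (auto simp: trees_def)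

lemma rooted_trees_0 [simp]: "rooted_trees N 0 i = {}"
  by (auto simp: rooted_trees_def)

lemma root_series_nth_0 [simp]: "root_series N i $ 0 = 0"
  by (simp add: root_series_def)

lemma tree_monom_Leaf [simp]: "tree_monom Leaf = 1"
  by (simp add: tree_monom_def tree_weight_def single_one)

lemma tree_weight_Node:
  "tree_weight (Node l i r) = left_edge i l * right_edge i r * tree_weight l * tree_weight r"
  by (auto simp: tree_weight_def left_edge_def right_edge_def power_add ac_simps split: tree.splits)

lemma tree_monom_Node:
  "tree_monom (Node l i r) = x_monom (Poly_Mapping.single i 1) 1 *
     (x_monom 0 (left_edge i l) * tree_monom l) * (x_monom 0 (right_edge i r) * tree_monom r)"
  by (simp add: tree_monom_def tree_weight_Node mult_single content_append content_Cons ac_simps)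

lemma sum_trees_by_root:
  "(\<Sum>T\<in>trees N n. f T) =
     (if n = 0 then f Leaf else 0) + (\<Sum>i\<in>{1..N}. \<Sum>T\<in>rooted_trees N n i. f T)"
proof (cases n)
  case (Suc k)
  have "trees N n = (\<Union>i\<in>{1..N}. rooted_trees N n i)"
  proof
    show "trees N n \<subseteq> (\<Union>i\<in>{1..N}. rooted_trees N n i)"
    proof
      fix T assume "T \<in> trees N n"
      then show "T \<in> (\<Union>i\<in>{1..N}. rooted_trees N n i)"
        using Suc by (cases T) (auto simp: rooted_trees_def trees_def)
    qed
  qed (auto simp: rooted_trees_def)
  moreover have "(\<Sum>T\<in>(\<Union>i\<in>{1..N}. rooted_trees N n i). f T) =
      (\<Sum>i\<in>{1..N}. \<Sum>T\<in>rooted_trees N n i. f T)"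
    by (rule sum.UNION_disjoint) (auto simp: rooted_trees_def)
  ultimately show ?thesis using Suc by simp
qed simp

lemma sum_threshold:
  fixes g :: "nat \<Rightarrow> 'a::comm_ring_1"
  assumes "i \<le> N"
  shows "(\<Sum>j\<in>{1..N}. (if j \<le> i then a else b) * g j) =
    a * sum g {1..i} + b * (sum g {1..N} - sum g {1..i})"
proof -
  have "sum h {1..N} = sum h {1..i} + sum h {Suc i..N}" for h :: "nat \<Rightarrow> 'a"
    using sum.ub_add_nat[of 1 i h "N - i"] assms by simp
  note this[of "\<lambda>j. (if j \<le> i then a else b) * g j"] this[of g]
  then show ?thesis by (simp add: sum_distrib_left)
qed

text \<open>The possible left subtrees of a root labeled \<open>i\<close>, weighted with their edge,
  give \<open>p i\<close> of the Riccati recursion.\<close>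

lemma left_series:
  assumes "i \<le> N"
  shows "Abs_fps (\<lambda>n. \<Sum>T\<in>trees N n. x_monom 0 (left_edge i T) * tree_monom T) =
    1 + fps_const (x_monom 0 (param_var Lam_bar)) * sum (root_series N) {1..i} +
    fps_const (x_monom 0 (param_var Lam)) *
      (sum (root_series N) {1..N} - sum (root_series N) {1..i})" (is "?L = _")
proof -
  let ?c = "\<lambda>j. if j \<le> i then fps_const (x_monom 0 (param_var Lam_bar))
    else fps_const (x_monom 0 (param_var Lam))"
  have "?L = 1 + (\<Sum>j\<in>{1..N}. ?c j * root_series N j)"
  proof (rule fps_ext)
    fix n
    have "(\<Sum>T\<in>rooted_trees N n j. x_monom 0 (left_edge i T) * tree_monom T) =
        (?c j * root_series N j) $ n" for j
      by (auto simp: root_series_def sum_distrib_left rooted_trees_def left_edge_def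
          intro!: sum.cong)
    then show "?L $ n = (1 + (\<Sum>j\<in>{1..N}. ?c j * root_series N j)) $ n"
      by (simp add: sum_trees_by_root fps_sum_nth left_edge_def single_one)
  qed
  then show ?thesis by (simp only: sum_threshold[OF assms] add.assoc)
qed

text \<open>This is \<open>q (i - 1)\<close> of the recursion: a right child with the same label
  \<open>i\<close> makes an ascent, so the descents are the labels up to
  \<open>i - 1\<close>.\<close>

lemma right_series:
  assumes "i \<in> {1..N}"
  shows "Abs_fps (\<lambda>n. \<Sum>T\<in>trees N n. x_monom 0 (right_edge i T) * tree_monom T) =
    1 + fps_const (x_monom 0 (param_var Rho_bar)) *
      (sum (root_series N) {1..N} - sum (root_series N) {1..i - 1}) +
    fps_const (x_monom 0 (param_var Rho)) * sum (root_series N) {1..i - 1}" (is "?L = _")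
proof -
  let ?c = "\<lambda>j. if j \<le> i - 1 then fps_const (x_monom 0 (param_var Rho))
    else fps_const (x_monom 0 (param_var Rho_bar))"
  have "?L = 1 + (\<Sum>j\<in>{1..N}. ?c j * root_series N j)"
  proof (rule fps_ext)
    fix n
    have "(\<Sum>T\<in>rooted_trees N n j. x_monom 0 (right_edge i T) * tree_monom T) =
        (?c j * root_series N j) $ n" for j
      using assms
      by (auto simp: root_series_def sum_distrib_left rooted_trees_def right_edge_def
          intro!: sum.cong)
    then show "?L $ n = (1 + (\<Sum>j\<in>{1..N}. ?c j * root_series N j)) $ n"
      by (simp add: sum_trees_by_root fps_sum_nth right_edge_def single_one)
  qed
  moreover have "i - 1 \<le> N" using assms by auto
  ultimately show ?thesis by (simp only: sum_threshold add_ac)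
qed

lemma root_series_eq:
  assumes "i \<in> {1..N}"
  shows "root_series N i = fps_X * fps_const (x_monom (Poly_Mapping.single i 1) 1) *
    Abs_fps (\<lambda>n. \<Sum>T\<in>trees N n. x_monom 0 (left_edge i T) * tree_monom T) *
    Abs_fps (\<lambda>n. \<Sum>T\<in>trees N n. x_monom 0 (right_edge i T) * tree_monom T)"
    (is "_ = fps_X * ?x * ?A * ?B")
proof (rule fps_ext)
  fix n
  show "root_series N i $ n = (fps_X * ?x * ?A * ?B) $ n"
  proof (cases n)
    case 0
    then show ?thesis by (simp add: mult.assoc)
  next
    case (Suc k)
    let ?f = "\<lambda>l r. tree_monom (Node l i r)"
    \<comment> \<open>A tree corresponds to its two subtrees and the size \<open>s\<close> of the
      left one; the root accounts for the factor \<open>fps_X\<close>.\<close>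
    have "(\<Sum>T\<in>rooted_trees N (Suc k) i. tree_monom T) =
        (\<Sum>(s, l, r)\<in>(SIGMA s:{0..k}. trees N s \<times> trees N (k - s)). ?f l r)"
      by (rule sum.reindex_bij_witness[of _ "\<lambda>(s, l, r). Node l i r"
            "\<lambda>T. case T of Node l v r \<Rightarrow> (size l, l, r)"])
         (use assms in \<open>auto simp: rooted_trees_def trees_def subset_iff\<close>)
    also have "\<dots> = (\<Sum>s=0..k. \<Sum>l\<in>trees N s. \<Sum>r\<in>trees N (k - s). ?f l r)"
      by (simp add: sum.Sigma sum.cartesian_product case_prod_unfold)
    also have "\<dots> = x_monom (Poly_Mapping.single i 1) 1 * (\<Sum>s=0..k. ?A $ s * ?B $ (k - s))"
      by (simp only: tree_monom_Node sum_distrib_left[symmetric] sum_distrib_right[symmetric])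
        (simp only: mult.assoc sum_distrib_left[symmetric] fps_nth_Abs_fps)
    also have "\<dots> = (?x * (?A * ?B)) $ k"
      by (simp only: fps_mult_left_const_nth fps_mult_nth[of ?A])
    also have "\<dots> = (fps_X * ?x * ?A * ?B) $ n"
      using Suc by (simp only: mult.assoc fps_X_mult_nth) simp
    finally show ?thesis using Suc by (simp add: root_series_def)
  qed
qed

section \<open>The fixed point equation and the positivity of its solution\<close>

abbreviation param_series :: "param \<Rightarrow> x_poly fps" where
  "param_series v \<equiv> fps_const (x_monom 0 (param_var v))"

definition bounded_tree_series :: "nat \<Rightarrow> x_poly fps" where
  "bounded_tree_series N = sum (root_series N) {1..N}"

definition ascent_series :: "nat \<Rightarrow> x_poly fps" where
  "ascent_series N = param_series Rho_bar + param_series Lam_bar +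
     param_series Rho_bar * param_series Lam_bar * bounded_tree_series N"

definition descent_series :: "nat \<Rightarrow> x_poly fps" where
  "descent_series N = param_series Rho + param_series Lam +
     param_series Rho * param_series Lam * bounded_tree_series N"

lemma prod_list_x_monom:
  "prod_list (map (\<lambda>i. fps_const (x_monom (Poly_Mapping.single i 1) 1)) w) =
     fps_const (x_monom (content w) 1)"
  by (induction w) (simp_all add: content_Cons mult_single single_one)

lemma bounded_tree_series_words:
  "\<exists>E. bounded_tree_series N = (\<Sum>k<n. fps_X ^ Suc k * (\<Sum>w\<in>words N (Suc k).
      fps_const (x_monom (content w) 1) *
      descent_prod (ascent_series N) (descent_series N) (adj (<) w))) + fps_X ^ n * E"
proof -
  define S where "S i = sum (root_series N) {1..i}" for i
  define p where "p i = 1 + param_series Lam_bar * S i + param_series Lam * (S N - S i)" for i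
  define q where "q i = 1 + param_series Rho_bar * (S N - S i) + param_series Rho * S i" for i
  define x where "x i = fps_const (x_monom (Poly_Mapping.single i 1) 1)" for i
  define y where "y i = fps_X * x i" for i
  define u where "u i = fps_right_inverse (q i) 1" for i
  define V where
    "V i = y i * (1 + param_series Rho * S N) * (1 + param_series Rho_bar * S N) * p i * u i" for i
  have S0: "S i $ 0 = 0" for i by (simp add: S_def fps_sum_nth)
  \<comment> \<open>The series \<open>S i\<close> has no constant term, so \<open>q i\<close> has
    constant term 1 and is invertible.\<close>
  have u: "q i * u i = 1" for i
    unfolding u_def by (rule fps_right_inverse) (simp add: q_def S0)
  have g: "root_series N i = y i * p i * q (i - 1)" if "i \<in> {1..N}" for i
    using root_series_eq[OF that] left_series[of i N] right_series[OF that] that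
    unfolding y_def x_def p_def q_def S_def by simp
  have SN: "S N = bounded_tree_series N" by (simp add: S_def bounded_tree_series_def)
  have a: "ascent_series N =
      param_series Rho_bar + param_series Lam_bar + param_series Rho_bar * param_series Lam_bar * S N"
    by (simp add: ascent_series_def SN)
  have b: "descent_series N =
      param_series Rho + param_series Lam + param_series Rho * param_series Lam * S N"
    by (simp add: descent_series_def SN)
  note lin = riccati_linear_system[OF S_def p_def q_def g u V_def a b]
  have "\<exists>E. sum V {1..N} = (\<Sum>k<n. fps_X ^ Suc k * (\<Sum>w\<in>words N (Suc k).
      prod_list (map x w) * descent_prod (ascent_series N) (descent_series N) (adj (<) w))) +
      fps_X ^ n * E"
    by (rule words_linear_system) (use lin(2) in \<open>simp add: y_def\<close>)
  moreover have total: "sum V {1..N} = bounded_tree_series N"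
    using lin(1) SN by simp
  ultimately show ?thesis
    unfolding total x_def prod_list_x_monom by -
qed

text \<open>A word of \<open>k + 1\<close> letters carries \<open>fps_X ^ Suc k\<close>, so
  coefficient \<open>n\<close> of the fixed point equation involves the tree series only in degrees
  below \<open>n\<close>.\<close>

lemma descent_positive_bounded_tree_series: "descent_positive n (\<lambda>N. bounded_tree_series N $ n)"
proof (induction n rule: less_induct)
  case (less n)
  let ?Q = "\<lambda>k N. \<Sum>w\<in>words N (Suc k). fps_const (x_monom (content w) 1) *
      descent_prod (ascent_series N) (descent_series N) (adj (<) w)"
  have eq: "bounded_tree_series N $ n = (\<Sum>k<n. ?Q k N $ (n - Suc k))" for N
  proof -
    \<comment> \<open>Expanding to order \<open>Suc n\<close> keeps the remainder out of coefficient
      \<open>n\<close>.\<close>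
    obtain E where E: "bounded_tree_series N = (\<Sum>k<Suc n. fps_X ^ Suc k * ?Q k N) + fps_X ^ Suc n * E"
      using bounded_tree_series_words[of N "Suc n"] ..
    have "bounded_tree_series N $ n = (\<Sum>k<Suc n. (fps_X ^ Suc k * ?Q k N) $ n) + (fps_X ^ Suc n * E) $ n"
      by (subst E) (simp only: fps_add_nth fps_sum_nth)
    also have "\<dots> = (\<Sum>k<Suc n. if k < n then ?Q k N $ (n - Suc k) else 0)"
      by (simp only: fps_X_power_mult_nth) (auto intro!: sum.cong)
    also have "\<dots> = (\<Sum>k<n. ?Q k N $ (n - Suc k))"
      by simp
    finally show ?thesis .
  qed
  have pos: "descent_positive n (\<lambda>N. ?Q k N $ (n - Suc k))" if "k < n" for k
  proof -
    have "descent_positive_upto (n - Suc k) bounded_tree_series"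
      using less that by (auto simp: descent_positive_upto_def)
    then have "descent_positive_upto (n - Suc k) ascent_series"
      "descent_positive_upto (n - Suc k) descent_series"
      unfolding ascent_series_def descent_series_def
      by (intro descent_positive_upto_add descent_positive_upto_mult
          descent_positive_upto_const nat_coeff_polys_param_var; simp)+
    from descent_positive_word_series[OF this, of "Suc k"] show ?thesis using that by simp
  qed
  show ?case
    unfolding eq by (rule descent_positive_sum) (rule pos, simp)
qed

section \<open>From bounded labels to the full tree series\<close>

lemma content_keys: "content w = m \<Longrightarrow> Poly_Mapping.keys m = set w"
  by (auto simp: in_keys_iff lookup_content count_list_0_iff)

lemma tree_series_nth:
  "tree_series m = (\<Sum>T | T \<noteq> Leaf \<and> 0 \<notin> set_tree T \<and> content (inorder T) = m. tree_weight T)"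
proof -
  let ?I = "{T. T \<noteq> Leaf \<and> 0 \<notin> set_tree T \<and> content (inorder T) = m}"
  have "finite ?I"
  proof (rule finite_subset)
    let ?K = "Poly_Mapping.keys m"
    show "finite {T. size T \<le> sum (Poly_Mapping.lookup m) ?K \<and> set_tree T \<subseteq> ?K}"
      by (simp add: finite_trees_bounded)
    show "?I \<subseteq> {T. size T \<le> sum (Poly_Mapping.lookup m) ?K \<and> set_tree T \<subseteq> ?K}"
    proof
      fix T assume "T \<in> ?I"
      then have "content (inorder T) = m" by simp
      from content_eq_bounds[OF this] show "T \<in> {T. size T \<le> sum (Poly_Mapping.lookup m) ?K \<and> set_tree T \<subseteq> ?K}"
        by simp
    qed
  qed
  moreover have "(\<Union>n\<in>{1..}. labeled_trees n) = {T. T \<noteq> Leaf \<and> 0 \<notin> set_tree T}"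
    by (auto simp: labeled_trees_def Suc_le_eq simp flip: neq0_conv)
  ultimately show ?thesis
    unfolding tree_series_def formal_sum_def
    by (intro sum.mono_neutral_cong_left) (auto simp: series_monom_def)
qed

lemma lookup_sum_single:
  "finite I \<Longrightarrow> Poly_Mapping.lookup (\<Sum>i\<in>I. Poly_Mapping.single (k i) (f i)) m =
     (\<Sum>i | i \<in> I \<and> k i = m. f i)"
  by (simp add: lookup_sum lookup_single when_def sum.If_cases Int_def)

text \<open>A monomial \<open>m\<close> fixes both the size and a bound on the labels. Since
  \<open>c\<close> does not depend on that bound, one \<open>c\<close> serves all monomials.\<close>

lemma tree_series_words:
  "\<exists>c. (\<forall>n D. c n D \<in> nat_coeff_polys) \<and>
     (\<forall>m. tree_series m = (\<Sum>w | 0 \<notin> set w \<and> content w = m. c (length w) (adj (<) w)))"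
proof -
  obtain c where c: "\<And>n D. c n D \<in> nat_coeff_polys"
    "\<And>n N. bounded_tree_series N $ n = (\<Sum>w\<in>words N n. x_monom (content w) (c n (adj (<) w)))"
    using descent_positive_bounded_tree_series unfolding descent_positive_def by metis
  have "tree_series m = (\<Sum>w | 0 \<notin> set w \<and> content w = m. c (length w) (adj (<) w))" for m
  proof -
    let ?K = "Poly_Mapping.keys m"
    let ?n = "sum (Poly_Mapping.lookup m) ?K"
    \<comment> \<open>The largest index occurring in \<open>m\<close>; the inserted 0 covers the
      monomial 1.\<close>
    define N where "N = Max (insert 0 ?K)"
    have K: "?K \<subseteq> {..N}" by (auto simp: N_def)
    have pos: "x \<in> {1..N} \<longleftrightarrow> x \<noteq> 0" if "x \<in> ?K" for x
      using K that by auto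
    \<comment> \<open>\<open>Leaf\<close> is removed because \<open>trees N 0\<close> contains it,
      while the tree series starts at size 1.\<close>
    have "bounded_tree_series N $ ?n = (\<Sum>T\<in>trees N ?n - {Leaf}. tree_monom T)"
    proof (cases "?n = 0")
      case True
      then show ?thesis
        by (simp only: trees_0) (simp add: bounded_tree_series_def fps_sum_nth)
    next
      case False
      then have "trees N ?n - {Leaf} = trees N ?n" by (auto simp: trees_def)
      then show ?thesis
        using False by (simp only: sum_trees_by_root) (simp add: bounded_tree_series_def fps_sum_nth root_series_def)
    qed
    then have "Poly_Mapping.lookup (bounded_tree_series N $ ?n) m =
        (\<Sum>T | T \<in> trees N ?n - {Leaf} \<and> content (inorder T) = m. tree_weight T)"
      by (simp only: tree_monom_def) (simp add: lookup_sum_single)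
    also have "{T. T \<in> trees N ?n - {Leaf} \<and> content (inorder T) = m} =
        {T. T \<noteq> Leaf \<and> 0 \<notin> set_tree T \<and> content (inorder T) = m}"
    proof -
      have "T \<in> trees N ?n \<longleftrightarrow> 0 \<notin> set_tree T" if "content (inorder T) = m" for T
        using content_eq_bounds(2)[OF that] content_keys[OF that] pos
        by (force simp: trees_def)
      then show ?thesis by blast
    qed
    finally have "tree_series m = Poly_Mapping.lookup (bounded_tree_series N $ ?n) m"
      by (simp only: tree_series_nth)
    also have "\<dots> = (\<Sum>w | w \<in> words N ?n \<and> content w = m. c ?n (adj (<) w))"
      unfolding c(2) by (simp add: lookup_sum_single)
    also have "\<dots> = (\<Sum>w | 0 \<notin> set w \<and> content w = m. c (length w) (adj (<) w))"
    proof (rule sum.cong)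
      have "w \<in> words N ?n \<longleftrightarrow> 0 \<notin> set w" if "content w = m" for w
        using content_eq_bounds(2)[OF that] content_keys[OF that] pos
        by (force simp: words_def)
      then show "{w. w \<in> words N ?n \<and> content w = m} = {w. 0 \<notin> set w \<and> content w = m}"
        by blast
    qed (use content_eq_bounds(2) in auto)
    finally show ?thesis .
  qed
  with c(1) show ?thesis by blast
qed

section \<open>From words to Schur functions\<close>

lemma sum_add_box: "k \<le> length \<mu> \<Longrightarrow> sum_list (add_box k \<mu>) = Suc (sum_list \<mu>)"
  by (induction k \<mu> rule: add_box.induct) auto

lemma length_add_box: "k \<le> length \<mu> \<Longrightarrow> length (add_box k \<mu>) \<le> Suc (length \<mu>)"
  by (induction k \<mu> rule: add_box.induct) auto

lemma lattice_word_bounds: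
  "lattice_word q \<Longrightarrow> sum_list (shape_of q) = length q \<and> length (shape_of q) \<le> length q \<and>
     set q \<subseteq> {..length q}"
proof (induction q)
  case (Cons k q)
  then show ?case
    using sum_add_box[of k "shape_of q"] length_add_box[of k "shape_of q"] by auto
qed auto

lemma finite_lattice_words: "finite {q. lattice_word q \<and> shape_of q = \<mu>}"
proof (rule finite_subset)
  show "finite {q. set q \<subseteq> {..sum_list \<mu>} \<and> length q = sum_list \<mu>}"
    by (simp add: finite_lists_length_eq)
qed (use lattice_word_bounds in fastforce)

lemma schur_nth: "schur \<mu> m = of_nat (card {t \<in> ssyt \<mu>. content (concat t) = m})"
proof -
  have "{t \<in> ssyt \<mu>. series_monom 1 (content (concat t)) m \<noteq> 0} =
      {t \<in> ssyt \<mu>. content (concat t) = m}"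
    by (auto simp: series_monom_def)
  then show ?thesis
    by (simp add: schur_def formal_sum_def series_monom_def)
qed

lemma tableau_length: "tableau t \<Longrightarrow> length t \<le> length (concat t)"
proof (induction t)
  case (Cons r t)
  then show ?case by (cases r) auto
qed simp

lemma finite_tableaux: "finite {t. tableau t \<and> content (concat t) = m}"
proof -
  let ?K = "Poly_Mapping.keys m"
  let ?n = "sum (Poly_Mapping.lookup m) ?K"
  let ?R = "{r. set r \<subseteq> ?K \<and> length r \<le> ?n}"
  have "{t. tableau t \<and> content (concat t) = m} \<subseteq> {t. set t \<subseteq> ?R \<and> length t \<le> ?n}"
  proof
    fix t assume "t \<in> {t. tableau t \<and> content (concat t) = m}"
    then have t: "tableau t" "content (concat t) = m" by auto
    have "length r \<le> length (concat t)" if "r \<in> set t" for r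
      unfolding length_concat using that by (intro member_le_sum_list) auto
    then show "t \<in> {t. set t \<subseteq> ?R \<and> length t \<le> ?n}"
      using content_eq_bounds[OF t(2)] tableau_length[OF t(1)] by auto
  qed
  then show ?thesis
    by (rule finite_subset) (intro finite_lists_length_le finite_keys)
qed

text \<open>RSK moves length and pattern of a word to the recording tableau \<open>q\<close>. The
  inner sum then depends on \<open>t\<close> only through its shape, which makes it a coefficient of
  a Schur function.\<close>

lemma sum_rsk:
  "(\<Sum>w | 0 \<notin> set w \<and> content w = m. f (length w) (adj (<) w)) =
   (\<Sum>t | tableau t \<and> content (concat t) = m.
      \<Sum>q | lattice_word q \<and> shape_of q = map length t. f (length q) (adj (>) q))"
proof -
  let ?W = "{w. 0 \<notin> set w \<and> content w = m}"
  let ?T = "{t. tableau t \<and> content (concat t) = m}"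
  let ?Q = "\<lambda>t. {q. lattice_word q \<and> shape_of q = map length t}"
  have bij: "bij_betw rsk ?W (Sigma ?T ?Q)"
    unfolding bij_betw_def
  proof
    show "inj_on rsk ?W" by (auto intro: inj_onI rsk_inj)
    show "rsk ` ?W = Sigma ?T ?Q"
    proof (intro set_eqI iffI)
      fix z assume "z \<in> rsk ` ?W"
      then obtain w where "w \<in> ?W" "rsk w = z" by blast
      then show "z \<in> Sigma ?T ?Q"
        using rsk_correct[of w "fst z" "snd z"] by (cases z) auto
    next
      fix z assume z: "z \<in> Sigma ?T ?Q"
      then obtain w where w: "0 \<notin> set w" "rsk w = z"
        using rsk_surj by (cases z) force
      moreover have "content w = m" using rsk_correct[OF w(1), of "fst z" "snd z"] z w by auto
      ultimately show "z \<in> rsk ` ?W" by blast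
    qed
  qed
  have "(\<Sum>w\<in>?W. f (length w) (adj (<) w)) =
      (\<Sum>w\<in>?W. case rsk w of (t, q) \<Rightarrow> f (length q) (adj (>) q))"
    by (intro sum.cong refl) (use rsk_correct in \<open>auto split: prod.splits\<close>)
  also have "\<dots> = (\<Sum>(t, q)\<in>Sigma ?T ?Q. f (length q) (adj (>) q))"
    by (rule sum.reindex_bij_betw[OF bij])
  also have "\<dots> = (\<Sum>t\<in>?T. \<Sum>q\<in>?Q t. f (length q) (adj (>) q))"
    using finite_tableaux finite_lattice_words by (simp add: sum.Sigma)
  finally show ?thesis .
qed

lemma schur_positiveI:
  assumes "\<And>\<mu>. C \<mu> \<in> nat_coeff_polys"
    and F: "\<And>m. F m = (\<Sum>t | tableau t \<and> content (concat t) = m. C (map length t))"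
  shows "schur_positive F"
proof -
  let ?P = "{\<mu>. partition \<mu>}"
  let ?T = "\<lambda>m. {t. tableau t \<and> content (concat t) = m}"
  let ?f = "\<lambda>\<mu>. series_scale (C \<mu>) (schur \<mu>)"
  have tab: "{t \<in> ssyt \<mu>. content (concat t) = m} = {t \<in> ?T m. map length t = \<mu>}"
    if "partition \<mu>" for \<mu> m
    using that tableau_iff by (auto simp: ssyt_def)
  \<comment> \<open>A shape contributes to \<open>m\<close> only if it has a tableau of content
    \<open>m\<close>, and there are finitely many such tableaux.\<close>
  have nz: "{\<mu> \<in> ?P. ?f \<mu> m \<noteq> 0} \<subseteq> map length ` ?T m" for m
  proof
    fix \<mu> assume "\<mu> \<in> {\<mu> \<in> ?P. ?f \<mu> m \<noteq> 0}"
    then have "partition \<mu>" and "schur \<mu> m \<noteq> 0"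
      by (auto simp: series_scale_def)
    then have "card {t \<in> ssyt \<mu>. content (concat t) = m} \<noteq> 0"
      by (metis of_nat_0 schur_nth)
    then have "{t \<in> ?T m. map length t = \<mu>} \<noteq> {}"
      unfolding tab[OF \<open>partition \<mu>\<close>] by (metis card.empty)
    then show "\<mu> \<in> map length ` ?T m" by blast
  qed
  have fin: "finite (map length ` ?T m)" for m
    by (intro finite_imageI finite_tableaux)
  have "formal_sum ?P ?f m = F m" for m
  proof -
    have "formal_sum ?P ?f m = (\<Sum>\<mu>\<in>map length ` ?T m. ?f \<mu> m)"
      unfolding formal_sum_def
      by (rule sum.mono_neutral_left[OF fin nz]) (use tableau_partition in auto)
    also have "\<dots> = (\<Sum>\<mu>\<in>map length ` ?T m. \<Sum>t | t \<in> ?T m \<and> map length t = \<mu>. C (map length t))"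
    proof (rule sum.cong[OF refl])
      fix \<mu> assume "\<mu> \<in> map length ` ?T m"
      then have "partition \<mu>" using tableau_partition by auto
      have "(\<Sum>t | t \<in> ?T m \<and> map length t = \<mu>. C (map length t)) =
          (\<Sum>t | t \<in> ?T m \<and> map length t = \<mu>. C \<mu>)"
        by (rule sum.cong) auto
      then show "?f \<mu> m = (\<Sum>t | t \<in> ?T m \<and> map length t = \<mu>. C (map length t))"
        by (simp only: series_scale_def schur_nth tab[OF \<open>partition \<mu>\<close>]) (simp add: mult.commute)
    qed
    also have "\<dots> = F m"
      unfolding F by (rule sum.group[OF finite_tableaux fin]) auto
    finally show ?thesis .
  qed
  moreover have "formally_summable ?P ?f"
    unfolding formally_summable_def using finite_subset[OF nz fin] by blast
  ultimately show ?thesis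
    unfolding schur_positive_def formally_sums_def
    using assms(1) by (intro exI[of _ C]) auto
qed

theorem theorem1p2:
  shows "schur_positive tree_series"
proof -
  obtain c where c: "\<And>n D. c n D \<in> nat_coeff_polys"
    "\<And>m. tree_series m = (\<Sum>w | 0 \<notin> set w \<and> content w = m. c (length w) (adj (<) w))"
    using tree_series_words by blast
  show ?thesis
  proof (rule schur_positiveI)
    \<comment> \<open>The coefficient of \<open>schur\<close> at \<mu> sums \<open>c\<close> over
      the descent patterns of the standard tableaux of shape \<mu>.\<close>
    show "(\<Sum>q | lattice_word q \<and> shape_of q = \<mu>. c (length q) (adj (>) q)) \<in> nat_coeff_polys" for \<mu>
      using c(1) by (intro nat_coeff_polys_sum)
  qed (simp only: c(2) sum_rsk)
qed

end
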